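(* There exist universal constants $a,b>0$ such that for every $\epsilon\in(0,1/e)$ and every positive integer $K$ with $$K \geq a \exp \left(b\,\frac{\log(1/\epsilon)}{\log\log(1/\epsilon)}\right),$$ one has $$\liminf_{n \to +\infty} \ \mathbb{P}\left(1 \in H_{\varphi}(\mathrm{UA}(n)^{\circ})\right) \geq 1 - \epsilon.$$
   Context: Write $[n]=\{1,\dots,n\}$. The uniform attachment tree $\mathrm{UA}(n)$, $n\ge 2$, is the random labeled tree on vertex set $[n]$ defined inductively: $\mathrm{UA}(2)$ is the unique tree on two vertices, and $\mathrm{UA}(n+1)$ is obtained from $\mathrm{UA}(n)$ by adding the vertex $n+1$ and an edge $\{i,n+1\}$ with $i\in[n]$ chosen uniformly at random. $T^\circ$ denotes the unlabeled copy (isomorphism class) of a labeled tree $T$; vertices of $T^\circ$ are denoted using the labels of $T$. For a tree $T$ with vertex set $V(T)$ and $u\in V(T)$, let $(T,u)$ be the tree rooted at $u$, and $(T,u)_{v\downarrow}$ the subtree consisting of $v$ and all its descendants when $T$ is rooted at $u$; $|\cdot|$ is the number of vertices. Define $$\varphi_T(u)=\prod_{v\in V(T)\setminus\{u\}} |(T,u)_{v\downarrow}| .$$ (This does not depend on the labeling of the tree.) $H_\varphi$ is the mapping which, given a tree $T$ with at least $K$ vertices, returns the set of $K$ vertices with smallest $\varphi_T$ values, ties being broken arbitrarily. *)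

theory Defs
  imports "HOL-Probability.Probability"
begin

type_synonym 'a graph = "'a set \<times> 'a set set"

abbreviation verts :: "'a graph \<Rightarrow> 'a set" where "verts G \<equiv> fst G"
abbreviation edges :: "'a graph \<Rightarrow> 'a set set" where "edges G \<equiv> snd G"

definition is_path :: "'a graph \<Rightarrow> 'a list \<Rightarrow> bool" where
  "is_path G p \<longleftrightarrow>
     p \<noteq> [] \<and> distinct p \<and> set p \<subseteq> verts G \<and> successively (\<lambda>x y. {x, y} \<in> edges G) p"

definition is_path_between :: "'a graph \<Rightarrow> 'a \<Rightarrow> 'a list \<Rightarrow> 'a \<Rightarrow> bool" where
  "is_path_between G u p w \<longleftrightarrow> is_path G p \<and> hd p = u \<and> last p = w"

definition simple_graph :: "'a graph \<Rightarrow> bool" where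
  "simple_graph G \<longleftrightarrow> (\<forall>e\<in>edges G. e \<subseteq> verts G \<and> card e = 2)"

definition connected_graph :: "'a graph \<Rightarrow> bool" where
  "connected_graph G \<longleftrightarrow>
     verts G \<noteq> {} \<and> (\<forall>u\<in>verts G. \<forall>w\<in>verts G. \<exists>p. is_path_between G u p w)"

definition acyclic_graph :: "'a graph \<Rightarrow> bool" where
  "acyclic_graph G \<longleftrightarrow> \<not> (\<exists>p. is_path G p \<and> length p \<ge> 3 \<and> {last p, hd p} \<in> edges G)"

definition is_tree :: "'a graph \<Rightarrow> bool" where
  "is_tree G \<longleftrightarrow> finite (verts G) \<and> simple_graph G \<and> connected_graph G \<and> acyclic_graph G"

definition graph_iso :: "('a \<Rightarrow> 'b) \<Rightarrow> 'a graph \<Rightarrow> 'b graph \<Rightarrow> bool" where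
  "graph_iso f G H \<longleftrightarrow> bij_betw f (verts G) (verts H) \<and> edges H = (\<lambda>e. f ` e) ` edges G"

definition unlabeled :: "'a graph \<Rightarrow> 'a graph set" where
  "unlabeled T = {S. \<exists>f. graph_iso f T S}"

text \<open>The vertices of an isomorphism class are made concrete by a realization: a representative
  \<open>C X\<close> of each class \<open>X\<close>, which depends on the class only and so carries no information about
  the labels, together with, for each labeled tree \<open>T\<close>, an isomorphism \<open>\<iota> T\<close> from \<open>T\<close> to the
  representative of its class. The vertex of the unlabeled copy that is denoted by the
  label \<open>v\<close> of \<open>T\<close> is \<open>\<iota> T v\<close>.\<close>

definition unlabeled_realization ::
    "('a graph set \<Rightarrow> 'a graph) \<Rightarrow> ('a graph \<Rightarrow> 'a \<Rightarrow> 'a) \<Rightarrow> bool" where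
  "unlabeled_realization C \<iota> \<longleftrightarrow> (\<forall>T. is_tree T \<longrightarrow> graph_iso (\<iota> T) T (C (unlabeled T)))"

text \<open>The vertex set of \<open>(T,u)\<^sub>v\<^sub>\<down>\<close>: in the tree \<open>T\<close> rooted at \<open>u\<close>, a vertex \<open>w\<close> is \<open>v\<close> or a
  descendant of \<open>v\<close> iff \<open>v\<close> lies on the unique path from \<open>u\<close> to \<open>w\<close>.\<close>

definition subtree_below :: "'a graph \<Rightarrow> 'a \<Rightarrow> 'a \<Rightarrow> 'a set" where
  "subtree_below T u v = {w \<in> verts T. \<exists>p. is_path_between T u p w \<and> v \<in> set p}"

definition phi :: "'a graph \<Rightarrow> 'a \<Rightarrow> nat" where
  "phi T u = (\<Prod>v\<in>verts T - {u}. card (subtree_below T u v))"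

text \<open>Ties may be broken arbitrarily, so this is a property of the map \<open>H\<close> and does not
  determine it.\<close>

definition is_H_phi :: "nat \<Rightarrow> ('a graph \<Rightarrow> 'a set) \<Rightarrow> bool" where
  "is_H_phi K H \<longleftrightarrow>
     (\<forall>T. is_tree T \<and> card (verts T) \<ge> K \<longrightarrow>
        H T \<subseteq> verts T \<and> card (H T) = K \<and>
        (\<forall>u\<in>H T. \<forall>v\<in>verts T - H T. phi T u \<le> phi T v))"

text \<open>Only \<open>n \<ge> 2\<close> is meaningful; the values at \<open>0\<close> and \<open>1\<close> are set to that at \<open>2\<close>.\<close>

fun UA :: "nat \<Rightarrow> nat graph pmf" where
  "UA 0 = return_pmf ({1, 2}, {{1, 2}})"
| "UA (Suc n) =
     (if n < 2 then return_pmf ({1, 2}, {{1, 2}})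
      else do {
        T \<leftarrow> UA n;
        i \<leftarrow> pmf_of_set {1..n};
        return_pmf (insert (Suc n) (verts T), insert {i, Suc n} (edges T))
      })"

end

theory Submission imports Defs begin

text \<open>
  Moving the root of a tree with \<open>n\<close> vertices across an edge that has \<open>s\<close> vertices on its far side
  multiplies \<open>\<phi>\<close> by \<open>(n - s) / s\<close>, because the subtree sizes below all other vertices stay the
  same. Along the path from \<open>1\<close> to \<open>v\<close> this gives \<open>\<phi>(1) = \<phi>(v) \<cdot> \<Prod> s / (n - s)\<close>, where \<open>s\<close> runs over
  the subtree sizes at the vertices of the path other than \<open>1\<close>; call the product the odds of \<open>v\<close>
  (lemma \<open>phi_root_eq_phi_times_odds\<close>). If vertex \<open>1\<close> is missed, then each of the \<open>K\<close> chosen vertices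
  has odds at least \<open>1\<close>, and it has to be shown that this is unlikely.

  A union bound over vertex labels is too weak for this: with probability at least of order \<open>1 / K\<close> a vertex
  labelled beyond \<open>K\<close> has odds at least \<open>1\<close>. Vertices are therefore named by their Ulam-Harris
  address, the list of birth ranks met on the way down from \<open>1\<close>. Every address \<open>js\<close> has a
  deterministic weight such that the expected fourth root of its odds is at most \<open>weight js\<close>
  (lemma \<open>shape_mean_odds_le\<close>). The \<open>K\<close> chosen vertices have distinct addresses; so if there are fewer
  than \<open>K\<close> addresses of weight at least \<open>1 / Q\<close>, one of the chosen vertices has a lighter address. By
  Markov's inequality that has probability at most the sum of all weights below \<open>1 / Q\<close>.

  The moment bound rests on the recursive structure of uniform attachment. Cutting the edge between
  the root and its first child leaves two trees whose sizes are uniformly distributed, and given the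
  sizes both parts are again uniform attachment trees (\<open>shape_mean_step\<close>). Following an address
  through these cuts, each cut replaces the current size by a uniformly chosen smaller one, and if
  \<open>a\<close> descents remain, this multiplies the bound by a factor of order \<open>(a + 1) powr (-1/4)\<close>.

  It remains to count. All sums of powers of weights factor over the entries of the address, and
  \<open>\<Sum> weight js powr (4 * u) \<le> exp (460 * 9 powr (1 / u))\<close> (lemma \<open>sum_weight_le\<close>). For
  \<open>u = 1/8\<close> this bounds the sum of the light weights by a constant multiple of \<open>1 / sqrt Q\<close>, which equals \<open>\<epsilon>\<close>
  for a suitable \<open>Q\<close> of order \<open>1 / \<epsilon>\<^sup>2\<close>. For general \<open>u\<close> it bounds the number of heavy addresses by
  \<open>Q powr (4 * u) * exp (460 * 9 powr (1 / u))\<close>; the choice \<open>u = 6 / (1 + ln (ln (1 / \<epsilon>)))\<close> makes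
  the second exponent of order \<open>sqrt (ln (1 / \<epsilon>))\<close> and the first one of order
  \<open>ln (1 / \<epsilon>) / ln (ln (1 / \<epsilon>))\<close>, which is the exponent in the theorem.
\<close>

section \<open>Moving the root across a bridge\<close>

lemma subtree_below_subset: "subtree_below T u v \<subseteq> verts T"
  by (auto simp: subtree_below_def)

lemma is_path_Cons:
  "is_path G (x # p) \<longleftrightarrow> x \<in> verts G \<and> x \<notin> set p \<and> (p = [] \<or> is_path G p \<and> {x, hd p} \<in> edges G)"
  by (cases p) (auto simp: is_path_def)

lemma is_path_rev: "is_path G (rev p) \<longleftrightarrow> is_path G p"
  by (auto simp: is_path_def successively_rev insert_commute)

lemma is_path_snoc:
  "is_path G (p @ [x]) \<longleftrightarrow> x \<in> verts G \<and> x \<notin> set p \<and> (p = [] \<or> is_path G p \<and> {last p, x} \<in> edges G)"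
  using is_path_rev[of G "p @ [x]"] is_path_Cons[of G x "rev p"]
  by (simp add: is_path_rev hd_rev insert_commute)

text \<open>Orientation matters: \<open>A\<close> is the side of the far end \<open>y\<close>, so that \<open>A\<close> will be the subtree below \<open>y\<close> seen from \<open>x\<close>.\<close>

definition bridge :: "'a graph \<Rightarrow> 'a set \<Rightarrow> 'a \<Rightarrow> 'a \<Rightarrow> bool" where
  "bridge G A x y \<longleftrightarrow> {x, y} \<in> edges G \<and> x \<in> verts G - A \<and> y \<in> A \<and> A \<subseteq> verts G \<and>
     (\<forall>a\<in>A. \<forall>b\<in>verts G - A. {a, b} \<in> edges G \<longrightarrow> a = y \<and> b = x)"

lemma bridge_unique:
  assumes "bridge G A x y" "a \<in> A" "b \<in> verts G" "b \<notin> A" "{a, b} \<in> edges G"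
  shows "a = y" "b = x"
  using assms unfolding bridge_def by blast+

lemma bridge_sym: "bridge G A x y \<Longrightarrow> bridge G (verts G - A) y x"
  by (auto simp: bridge_def insert_commute double_diff)

text \<open>The only way out of \<open>A\<close> leads through \<open>y\<close>.\<close>

lemma path_stays:
  assumes "bridge G A x y" "is_path G p" "hd p \<in> A" "y \<notin> set p"
  shows "set p \<subseteq> A"
  using assms(2-)
proof (induction p)
  case (Cons a p)
  show ?case
  proof (cases "p = []")
    case False
    then have p: "is_path G p" "{a, hd p} \<in> edges G" using Cons.prems by (auto simp: is_path_Cons)
    have "hd p \<in> verts G" using p False by (auto simp: is_path_def)
    then have "hd p \<in> A"
      using bridge_unique(1)[OF assms(1), of a "hd p"] p(2) Cons.prems(2,3) by auto
    then show ?thesis using Cons p by auto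
  qed (use Cons in auto)
qed simp

text \<open>A path that starts at \<open>x\<close> can enter \<open>A\<close> only in its first step, since it would have to return to \<open>x\<close> to use the bridge later; for the same reason it cannot leave \<open>A\<close> again.\<close>

lemma path_from_bridge:
  assumes br: "bridge G A x y" and p: "is_path G p" "hd p = x"
  shows "set p \<inter> A = {} \<or> (\<exists>q. p = x # q \<and> is_path G q \<and> hd q = y \<and> set q \<subseteq> A)"
proof -
  obtain q where q: "p = x # q" using p by (cases p) (auto simp: is_path_def)
  show ?thesis
  proof (cases "q = []")
    case False
    have q': "is_path G q" "{x, hd q} \<in> edges G" "x \<notin> set q" "hd q \<in> verts G"
    proof -
      show *: "is_path G q" "{x, hd q} \<in> edges G" "x \<notin> set q"
        using p(1) False unfolding q is_path_Cons by simp_all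
      have "set q \<subseteq> verts G" using *(1) unfolding is_path_def by simp
      then show "hd q \<in> verts G" using hd_in_set[OF False] by blast
    qed
    show ?thesis
    proof (cases "hd q \<in> A")
      case True
      then have "hd q = y"
        using bridge_unique(1)[OF br True, of x] br q'(2) by (simp add: bridge_def insert_commute)
      have "set (tl q) \<subseteq> A"
      proof (cases "tl q = []")
        case False
        then obtain z r where r: "q = y # z # r"
          using \<open>hd q = y\<close> \<open>q \<noteq> []\<close> by (metis list.collapse)
        have z: "{y, z} \<in> edges G" "z \<in> verts G" "z \<noteq> x" "y \<notin> set (z # r)" "is_path G (z # r)"
          using q'(1,3) unfolding r by (auto simp: is_path_Cons is_path_def[of G "z # r"])
        moreover have "y \<in> A" using br by (simp add: bridge_def)
        ultimately have "z \<in> A" using bridge_unique(2)[OF br, of y z] by blast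
        then show ?thesis using path_stays[OF br z(5)] z r by auto
      qed simp
      then show ?thesis using q q' True \<open>hd q = y\<close> by (cases q) auto
    next
      case False
      then have "set q \<subseteq> verts G - A"
        using path_stays[OF bridge_sym[OF br] q'(1)] q' by auto
      then show ?thesis using q br by (auto simp: bridge_def)
    qed
  qed (use q br in \<open>auto simp: bridge_def\<close>)
qed

lemma subtree_below_across_bridge:
  assumes br: "bridge G A x y" and conn: "connected_graph G"
  shows "subtree_below G x y = A"
proof (intro equalityI subsetI)
  fix w assume "w \<in> subtree_below G x y"
  then obtain p where p: "is_path G p" "hd p = x" "last p = w" "y \<in> set p"
    by (auto simp: subtree_below_def is_path_between_def)
  have "y \<in> A" "x \<notin> A" using br by (auto simp: bridge_def)
  then obtain q where "p = x # q" "is_path G q" "hd q = y" "set q \<subseteq> A"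
    using path_from_bridge[OF br p(1,2)] p(4) by auto
  then show "w \<in> A" using p by (auto simp: is_path_def)
next
  fix w assume w: "w \<in> A"
  have V: "x \<in> verts G" "w \<in> verts G" "x \<notin> A" using br w by (auto simp: bridge_def)
  then obtain p where p: "is_path G p" "hd p = x" "last p = w"
    using conn unfolding connected_graph_def is_path_between_def by blast
  have "w \<in> set p" using p by (auto simp: is_path_def)
  then obtain q where "p = x # q" "is_path G q" "hd q = y" 
    using path_from_bridge[OF br p(1,2)] w by auto
  then have "y \<in> set p" by (auto simp: is_path_def)
  then show "w \<in> subtree_below G x y"
    unfolding subtree_below_def is_path_between_def using p V(2) by blast
qed

text \<open>Paths from \<open>x\<close> become paths from \<open>y\<close> by dropping \<open>x\<close> if they cross the bridge and by prepending \<open>y\<close> otherwise.\<close>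

lemma subtree_below_move_root_subset:
  assumes br: "bridge G A x y" and v: "v \<noteq> x" "v \<noteq> y"
  shows "subtree_below G x v \<subseteq> subtree_below G y v"
proof
  fix w assume "w \<in> subtree_below G x v"
  then obtain p where p: "is_path G p" "hd p = x" "last p = w" "v \<in> set p" "w \<in> verts G"
    by (auto simp: subtree_below_def is_path_between_def)
  have y: "y \<in> A" "y \<in> verts G" "{y, x} \<in> edges G" using br by (auto simp: bridge_def insert_commute)
  from path_from_bridge[OF br p(1,2)] show "w \<in> subtree_below G y v"
  proof (elim disjE exE conjE)
    assume "set p \<inter> A = {}"
    moreover have "p \<noteq> []" using p by (simp add: is_path_def)
    ultimately have "is_path G (y # p)" "p \<noteq> []" using y p by (auto simp: is_path_Cons)
    then have "is_path G (y # p) \<and> hd (y # p) = y \<and> last (y # p) = w \<and> v \<in> set (y # p)" using p by simp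
    then show ?thesis unfolding subtree_below_def is_path_between_def using p by blast
  next
    fix q assume q: "p = x # q" "is_path G q" "hd q = y" "set q \<subseteq> A"
    then have "last q = w" "v \<in> set q" using p v by (auto simp: is_path_def)
    then show ?thesis unfolding subtree_below_def is_path_between_def using p q by blast
  qed
qed

lemma subtree_below_move_root:
  assumes "bridge G A x y" "v \<noteq> x" "v \<noteq> y"
  shows "subtree_below G x v = subtree_below G y v"
  using subtree_below_move_root_subset[OF assms]
    subtree_below_move_root_subset[OF bridge_sym[OF assms(1)] assms(3,2)] by blast

text \<open>The products defining \<open>phi G x\<close> and \<open>phi G y\<close> share all factors except the one that counts the far side of the bridge.\<close>

lemma phi_across_bridge:
  assumes br: "bridge G A x y" and conn: "connected_graph G" and fin: "finite (verts G)"
  shows "phi G y * card A = phi G x * (card (verts G) - card A)"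
proof -
  have *: "x \<noteq> y" "x \<in> verts G" "y \<in> verts G" "A \<subseteq> verts G" using br by (auto simp: bridge_def)
  define R where "R = (\<Prod>v\<in>verts G - {x, y}. card (subtree_below G x v))"
  have S: "verts G - {x} = insert y (verts G - {x, y})" "verts G - {y} = insert x (verts G - {x, y})"
    using * by auto
  have "phi G x = card A * R"
    unfolding phi_def S R_def using fin
    by (subst prod.insert) (auto simp: subtree_below_across_bridge[OF br conn])
  moreover have "phi G y = card (verts G - A) * (\<Prod>v\<in>verts G - {x, y}. card (subtree_below G y v))"
    unfolding phi_def S using fin
    by (subst prod.insert) (auto simp: subtree_below_across_bridge[OF bridge_sym[OF br] conn])
  moreover have "(\<Prod>v\<in>verts G - {x, y}. card (subtree_below G y v)) = R"
    unfolding R_def using subtree_below_move_root[OF br] by (intro prod.cong) auto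
  moreover have "card (verts G - A) = card (verts G) - card A"
    using * fin by (meson card_Diff_subset finite_subset)
  ultimately show ?thesis by simp
qed

lemma phi_pos:
  assumes conn: "connected_graph G" and fin: "finite (verts G)" and u: "u \<in> verts G"
  shows "phi G u > 0"
proof -
  have "card (subtree_below G u v) > 0" if v: "v \<in> verts G" for v
  proof -
    obtain p where "is_path G p" "hd p = u" "last p = v"
      using conn u v unfolding connected_graph_def is_path_between_def by blast
    then have "v \<in> subtree_below G u v"
      unfolding subtree_below_def is_path_between_def using v by (auto simp: is_path_def)
    then show ?thesis using finite_subset[OF subtree_below_subset fin] by (auto simp: card_gt_0_iff)
  qed
  then show ?thesis unfolding phi_def by (intro prod_pos) auto
qed

section \<open>Pendant vertices and isomorphisms\<close>

text \<open>The new vertex \<open>k\<close> has \<open>i\<close> as its only neighbour, so on a cycle through \<open>k\<close> the vertex \<open>i\<close> would appear twice.\<close>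

lemma is_tree_add_pendant:
  assumes T: "is_tree (V, E)" and i: "i \<in> V" and k: "k \<notin> V"
  shows "is_tree (insert k V, insert {i, k} E)"
proof -
  let ?G = "(V, E)" and ?G' = "(insert k V, insert {i, k} E)"
  have E: "\<And>e. e \<in> E \<Longrightarrow> e \<subseteq> V" using T by (auto simp: is_tree_def simple_graph_def)
  have ik: "i \<noteq> k" using i k by auto
  have nbr: "{a, k} \<in> insert {i, k} E \<longleftrightarrow> a = i" for a
    using E[of "{a, k}"] k by (auto simp: doubleton_eq_iff)
  have old: "{a, b} \<in> insert {i, k} E \<longleftrightarrow> {a, b} \<in> E" if "a \<noteq> k" "b \<noteq> k" for a b
    using that by (auto simp: doubleton_eq_iff)
  have path_old: "is_path ?G' p \<longleftrightarrow> is_path ?G p" if "k \<notin> set p" for p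
    using that
  proof (induction p)
    case (Cons a p)
    then show ?case using old[of a "hd p"] by (cases "p = []") (auto simp: is_path_Cons)
  qed (simp add: is_path_def)
  have inV: "set p \<subseteq> V" if "is_path ?G p" for p using that by (auto simp: is_path_def)
  have conn: "\<exists>p. is_path ?G p \<and> hd p = u \<and> last p = w" if "u \<in> V" "w \<in> V" for u w
    using T that unfolding is_tree_def connected_graph_def is_path_between_def by auto
  have "\<exists>p. is_path ?G' p \<and> hd p = u \<and> last p = w" if "u \<in> insert k V" "w \<in> insert k V" for u w
  proof -
    consider "u = k" "w = k" | "u = k" "w \<in> V" | "u \<in> V" "w = k" | "u \<in> V" "w \<in> V" using \<open>u \<in> insert k V\<close> \<open>w \<in> insert k V\<close> by auto
    then show ?thesis
    proof cases
      case 1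
      then show ?thesis by (intro exI[of _ "[k]"]) (auto simp: is_path_Cons)
    next
      case 2
      obtain p where p: "is_path ?G p" "hd p = i" "last p = w" using conn[OF i 2(2)] by auto
      then have "k \<notin> set p" "p \<noteq> []" using k inV[of p] by (auto simp: is_path_def)
      then show ?thesis using p 2 path_old[of p]
        by (intro exI[of _ "k # p"]) (auto simp: is_path_Cons insert_commute)
    next
      case 3
      obtain p where p: "is_path ?G p" "hd p = u" "last p = i" using conn[OF 3(1) i] by auto
      then have "k \<notin> set p" "p \<noteq> []" using k inV[of p] by (auto simp: is_path_def)
      then show ?thesis using p 3 path_old[of p]
        by (intro exI[of _ "p @ [k]"]) (auto simp: is_path_snoc)
    next
      case 4
      obtain p where p: "is_path ?G p" "hd p = u" "last p = w" using conn[OF 4] by auto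
      then have "k \<notin> set p" using k inV[of p] by auto
      then show ?thesis using p path_old[of p] by auto
    qed
  qed
  then have "connected_graph ?G'"
    unfolding connected_graph_def is_path_between_def by auto
  moreover have "acyclic_graph ?G'"
    unfolding acyclic_graph_def
  proof (intro notI, elim exE conjE)
    fix p assume p: "is_path ?G' p" "length p \<ge> 3" and cyc: "{last p, hd p} \<in> edges ?G'"
    show False
    proof (cases "k \<in> set p")
      case False
      then have "is_path ?G p" "last p \<noteq> k" "hd p \<noteq> k" using p path_old[of p] by (auto simp: is_path_def)
      then show False using T p cyc old[of "last p" "hd p"] unfolding is_tree_def acyclic_graph_def by auto
    next
      case True
      then obtain q r where qr: "p = q @ k # r" by (meson split_list)
      have d: "distinct p" using p by (auto simp: is_path_def)
      have succ: "successively (\<lambda>x y. {x, y} \<in> insert {i, k} E) p" using p by (auto simp: is_path_def)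
      have q: "last q = i" if "q \<noteq> []"
        using succ that unfolding qr by (simp only: successively_append_iff list.sel nbr) simp
      have r: "hd r = i" if "r \<noteq> []"
      proof -
        have "successively (\<lambda>x y. {x, y} \<in> insert {i, k} E) (k # r)"
          using succ unfolding qr by (simp only: successively_append_iff)
        then have "{hd r, k} \<in> insert {i, k} E"
          using that by (cases r) (simp_all only: successively.simps list.sel insert_commute)
        then show ?thesis by (simp only: nbr)
      qed
      consider "q \<noteq> []" "r \<noteq> []" | "q = []" "length r \<ge> 2" | "r = []" "length q \<ge> 2"
        using p(2) unfolding qr by (cases q; cases r) auto
      then show False
      proof cases
        case 1
        then have "i \<in> set q" "i \<in> set r" using q r by (metis last_in_set, metis hd_in_set)
        then show False using d unfolding qr by auto
      next
        case 2
        then obtain z r' where zr: "r = i # z # r'" using r by (auto simp: numeral_2_eq_2 Suc_le_length_iff)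
        have "last p = i" using cyc unfolding qr 2 by (simp only: append.simps list.sel snd_conv nbr)
        then show False using d unfolding qr zr 2 by (auto split: if_splits)
      next
        case 3
        have "{hd q, k} \<in> insert {i, k} E" using cyc 3 unfolding qr by (cases q) (auto simp: insert_commute)
        then have "hd q = i" by (simp only: nbr)
        moreover obtain z q' where zq: "q = z # q'" "q' \<noteq> []" using 3 by (auto simp: numeral_2_eq_2 Suc_le_length_iff)
        ultimately show False using d q zq unfolding qr by (auto dest: last_in_set)
      qed
    qed
  qed
  moreover have "finite (insert k V)" "simple_graph ?G'"
    using T i ik by (auto simp: is_tree_def simple_graph_def)
  ultimately show ?thesis by (simp add: is_tree_def)
qed

lemma graph_iso_edge_iff:
  assumes iso: "graph_iso f G H" and sg: "simple_graph G" and ab: "a \<in> verts G" "b \<in> verts G"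
  shows "{f a, f b} \<in> edges H \<longleftrightarrow> {a, b} \<in> edges G"
proof
  assume "{f a, f b} \<in> edges H"
  then obtain e where e: "e \<in> edges G" "f ` {a, b} = f ` e"
    using iso by (auto simp: graph_iso_def)
  moreover have "inj_on f (verts G)" using iso by (auto simp: graph_iso_def bij_betw_def)
  moreover have "e \<subseteq> verts G" using sg e by (auto simp: simple_graph_def)
  ultimately have "{a, b} = e" using ab by (subst (asm) inj_on_image_eq_iff) auto
  then show "{a, b} \<in> edges G" using e by simp
next
  assume "{a, b} \<in> edges G"
  then have "f ` {a, b} \<in> edges H" using iso unfolding graph_iso_def by blast
  then show "{f a, f b} \<in> edges H" by simp
qed

lemma is_path_map_iff:
  assumes iso: "graph_iso f G H" and sg: "simple_graph G" and p: "set p \<subseteq> verts G"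
  shows "is_path H (map f p) \<longleftrightarrow> is_path G p"
  using p
proof (induction p)
  case (Cons a p)
  have inj: "inj_on f (verts G)" and im: "f ` verts G = verts H"
    using iso by (auto simp: graph_iso_def bij_betw_def)
  have "f a \<in> f ` set p \<longleftrightarrow> a \<in> set p"
    using inj Cons.prems by (intro inj_on_image_mem_iff[OF inj]) auto
  moreover have "{f a, hd (map f p)} \<in> edges H \<longleftrightarrow> {a, hd p} \<in> edges G" if "p \<noteq> []"
    using that Cons.prems graph_iso_edge_iff[OF iso sg, of a "hd p"]
    by (auto simp: hd_map) (meson list.set_sel(1) subsetD)+
  ultimately show ?case using Cons im by (auto simp: is_path_Cons)
qed (simp add: is_path_def)

lemma path_preimage:
  assumes iso: "graph_iso f G H" and q: "set q \<subseteq> verts H"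
  obtains p where "q = map f p" "set p \<subseteq> verts G"
proof -
  have "q \<in> lists (f ` verts G)" using iso q by (auto simp: graph_iso_def bij_betw_def)
  then show ?thesis using that by (auto simp: lists_image)
qed

lemma is_tree_iso:
  assumes iso: "graph_iso f G H" and T: "is_tree G"
  shows "is_tree H"
proof -
  have sg: "simple_graph G" and fin: "finite (verts G)" using T by (auto simp: is_tree_def)
  have inj: "inj_on f (verts G)" and im: "verts H = f ` verts G" and ed: "edges H = (\<lambda>e. f ` e) ` edges G"
    using iso by (auto simp: graph_iso_def bij_betw_def)
  have "simple_graph H"
    unfolding simple_graph_def ed im
  proof (intro ballI, elim imageE)
    fix e e' assume e: "e' = f ` e" "e \<in> edges G"
    then have "e \<subseteq> verts G" "card e = 2" using sg by (auto simp: simple_graph_def)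
    then show "e' \<subseteq> f ` verts G \<and> card e' = 2"
      using e card_image[OF inj_on_subset[OF inj]] by auto
  qed
  moreover have "connected_graph H"
    unfolding connected_graph_def im is_path_between_def
  proof (intro conjI ballI)
    show "f ` verts G \<noteq> {}" using T by (auto simp: is_tree_def connected_graph_def)
    fix u w assume "u \<in> f ` verts G" "w \<in> f ` verts G"
    then obtain a b where ab: "a \<in> verts G" "b \<in> verts G" "u = f a" "w = f b" by auto
    then obtain p where p: "is_path G p" "hd p = a" "last p = b"
      using T unfolding is_tree_def connected_graph_def is_path_between_def by blast
    then have "p \<noteq> []" "set p \<subseteq> verts G" by (auto simp: is_path_def)
    then show "\<exists>p. is_path H p \<and> hd p = u \<and> last p = w"
      using p ab is_path_map_iff[OF iso sg] by (intro exI[of _ "map f p"]) (auto simp: hd_map last_map)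
  qed
  moreover have "acyclic_graph H"
    unfolding acyclic_graph_def
  proof (intro notI, elim exE conjE)
    fix q assume q: "is_path H q" "length q \<ge> 3" "{last q, hd q} \<in> edges H"
    then obtain p where p: "q = map f p" "set p \<subseteq> verts G"
      using path_preimage[OF iso] by (metis is_path_def)
    have "p \<noteq> []" using p q by auto
    then have "last p \<in> verts G" "hd p \<in> verts G" using p by auto
    then have "{last p, hd p} \<in> edges G"
      using q \<open>p \<noteq> []\<close> graph_iso_edge_iff[OF iso sg] by (auto simp: p hd_map last_map)
    moreover have "is_path G p" using q p is_path_map_iff[OF iso sg] by auto
    ultimately show False using T q p unfolding is_tree_def acyclic_graph_def by auto
  qed
  ultimately show ?thesis using fin im by (simp add: is_tree_def)
qed

lemma subtree_below_iso:
  assumes iso: "graph_iso f G H" and sg: "simple_graph G" and uv: "u \<in> verts G" "v \<in> verts G"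
  shows "subtree_below H (f u) (f v) = f ` subtree_below G u v"
proof -
  have inj: "inj_on f (verts G)" and im: "verts H = f ` verts G"
    using iso by (auto simp: graph_iso_def bij_betw_def)
  have *: "(\<exists>q. is_path H q \<and> hd q = f u \<and> last q = f w \<and> f v \<in> set q) \<longleftrightarrow>
        (\<exists>p. is_path G p \<and> hd p = u \<and> last p = w \<and> v \<in> set p)" if w: "w \<in> verts G" for w
  proof
    assume "\<exists>q. is_path H q \<and> hd q = f u \<and> last q = f w \<and> f v \<in> set q"
    then obtain q where q: "is_path H q" "hd q = f u" "last q = f w" "f v \<in> set q" by blast
    then obtain p where p: "q = map f p" "set p \<subseteq> verts G"
      using path_preimage[OF iso] by (metis is_path_def)
    have ne: "p \<noteq> []" using q p by (auto simp: is_path_def)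
    have "hd p \<in> verts G" "last p \<in> verts G" using p ne by auto
    then have "hd p = u" "last p = w" 
      using q ne inj uv w by (auto simp: p hd_map last_map dest: inj_onD)
    moreover have "v \<in> set p" using q(4) p inj uv by (auto simp: p inj_on_image_mem_iff[OF inj])
    ultimately show "\<exists>p. is_path G p \<and> hd p = u \<and> last p = w \<and> v \<in> set p"
      using q p is_path_map_iff[OF iso sg] by auto
  next
    assume "\<exists>p. is_path G p \<and> hd p = u \<and> last p = w \<and> v \<in> set p"
    then obtain p where p: "is_path G p" "hd p = u" "last p = w" "v \<in> set p" by blast
    then have "p \<noteq> []" "set p \<subseteq> verts G" by (auto simp: is_path_def)
    then show "\<exists>q. is_path H q \<and> hd q = f u \<and> last q = f w \<and> f v \<in> set q"
      using p is_path_map_iff[OF iso sg] by (intro exI[of _ "map f p"]) (auto simp: hd_map last_map)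
  qed
  have "subtree_below H (f u) (f v)
      = {w' \<in> f ` verts G. \<exists>q. is_path H q \<and> hd q = f u \<and> last q = w' \<and> f v \<in> set q}"
    unfolding subtree_below_def is_path_between_def im by simp
  also have "\<dots> = f ` {w \<in> verts G. \<exists>q. is_path H q \<and> hd q = f u \<and> last q = f w \<and> f v \<in> set q}"
    by auto
  also have "\<dots> = f ` {w \<in> verts G. \<exists>p. is_path G p \<and> hd p = u \<and> last p = w \<and> v \<in> set p}"
    by (rule arg_cong[where f = "(`) f"]) (use * in blast)
  also have "\<dots> = f ` subtree_below G u v"
    unfolding subtree_below_def is_path_between_def by simp
  finally show ?thesis .
qed

lemma phi_iso:
  assumes iso: "graph_iso f G H" and sg: "simple_graph G" and u: "u \<in> verts G"
  shows "phi H (f u) = phi G u"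
proof -
  have inj: "inj_on f (verts G)" and im: "verts H = f ` verts G"
    using iso by (auto simp: graph_iso_def bij_betw_def)
  have "verts H - {f u} = f ` (verts G - {u})" using inj u im by (auto dest: inj_onD)
  then have "phi H (f u) = (\<Prod>v\<in>verts G - {u}. card (subtree_below H (f u) (f v)))"
    unfolding phi_def using prod.reindex[OF inj_on_subset[OF inj, of "verts G - {u}"]] by simp
  also have "\<dots> = phi G u"
    unfolding phi_def
  proof (intro prod.cong refl)
    fix v assume "v \<in> verts G - {u}"
    then show "card (subtree_below H (f u) (f v)) = card (subtree_below G u v)"
      using subtree_below_iso[OF iso sg u, of v] card_image[OF inj_on_subset[OF inj subtree_below_subset]]
      by simp
  qed
  finally show ?thesis .
qed

section \<open>Growing trees as binary trees\<close>

text \<open>A growing tree is encoded by recursively cutting its oldest edge at the root: \<open>Br l r\<close> stands for the tree in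
  which \<open>r\<close> is the subtree of the first child of the root and \<open>l\<close> is the rest. The vertices are the
  leaves, and attaching \<open>k\<close> to the vertex \<open>i\<close> replaces \<open>Leaf i\<close> by \<open>Br (Leaf i) (Leaf k)\<close>, since \<open>k\<close> becomes the youngest
  child of \<open>i\<close>. This is what makes the recursive structure of uniform attachment visible.\<close>

datatype 'a btree = Leaf 'a | Br "'a btree" "'a btree"

fun leaves :: "'a btree \<Rightarrow> nat" where
  "leaves (Leaf x) = 1"
| "leaves (Br l r) = leaves l + leaves r"

lemma leaves_pos: "leaves B > 0"
  by (induction B) auto

fun root_label :: "'a btree \<Rightarrow> 'a" where
  "root_label (Leaf x) = x"
| "root_label (Br l r) = root_label l"

fun btree_edges :: "'a btree \<Rightarrow> 'a set set" where
  "btree_edges (Leaf x) = {}"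
| "btree_edges (Br l r) = insert {root_label l, root_label r} (btree_edges l \<union> btree_edges r)"

definition btree_graph :: "'a btree \<Rightarrow> 'a graph" where
  "btree_graph B = (set_btree B, btree_edges B)"

fun leaves_distinct :: "'a btree \<Rightarrow> bool" where
  "leaves_distinct (Leaf x) \<longleftrightarrow> True"
| "leaves_distinct (Br l r) \<longleftrightarrow> leaves_distinct l \<and> leaves_distinct r \<and> set_btree l \<inter> set_btree r = {}"

text \<open>The Ulam-Harris address: \<open>0\<close> is the first child, \<open>1\<close> the second child, and the root has the address \<open>[]\<close>. Skipping a child increments the head, unless the vertex is the root itself.\<close>

fun address :: "'a btree \<Rightarrow> 'a \<Rightarrow> nat list" where
  "address (Leaf x) v = []"
| "address (Br l r) v = (if v \<in> set_btree r then 0 # address r v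
     else (case address l v of [] \<Rightarrow> [] | j # js \<Rightarrow> Suc j # js))"

text \<open>In the graph of a tree with \<open>n\<close> vertices, the product of \<open>s / (n - s)\<close> over all subtree sizes \<open>s\<close> met while following
  an address downwards. The value \<open>0\<close> at an address that does not occur means that absent vertices contribute nothing to the expectations below.\<close>

fun odds :: "nat \<Rightarrow> 'a btree \<Rightarrow> nat list \<Rightarrow> real" where
  "odds n B [] = 1"
| "odds n (Leaf x) (j # js) = 0"
| "odds n (Br l r) (0 # js) = leaves r / (real n - leaves r) * odds n r js"
| "odds n (Br l r) (Suc j # js) = odds n l (j # js)"

lemma finite_set_btree [simp]: "finite (set_btree B)"
  by (induction B) auto

lemma root_in_set_btree [simp]: "root_label B \<in> set_btree B"
  by (induction B) auto

lemma btree_edges_subset: "e \<in> btree_edges B \<Longrightarrow> e \<subseteq> set_btree B"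
  by (induction B) auto

lemma card_set_btree: "leaves_distinct B \<Longrightarrow> card (set_btree B) = leaves B"
  by (induction B) (auto simp: card_Un_disjoint)

lemma inj_on_address: "leaves_distinct B \<Longrightarrow> inj_on (address B) (set_btree B)"
proof (induction B)
  case (Br l r)
  show ?case
  proof (rule inj_onI)
    fix v w assume vw: "v \<in> set_btree (Br l r)" "w \<in> set_btree (Br l r)" "address (Br l r) v = address (Br l r) w"
    consider "v \<in> set_btree r" "w \<in> set_btree r" | "v \<notin> set_btree r" "w \<notin> set_btree r"
      using vw(3) by (auto split: if_splits list.splits)
    then show "v = w"
    proof cases
      case 1
      then show ?thesis using vw Br by (auto dest: inj_onD)
    next
      case 2
      then have "address l v = address l w" using vw(3) by (auto split: list.splits)
      then show ?thesis using 2 vw Br by (auto dest: inj_onD)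
    qed
  qed
qed auto

text \<open>The induction along an address needs every subtree \<open>B\<close> to sit in the whole graph \<open>G\<close> in such a way that nothing else is attached
  to it except at its root. A right branch is then separated from the rest by a single edge, whereas the
  root of a left branch may have further neighbours outside.\<close>

definition attached_at_root :: "'a graph \<Rightarrow> 'a btree \<Rightarrow> bool" where
  "attached_at_root G B \<longleftrightarrow> set_btree B \<subseteq> verts G \<and> btree_edges B \<subseteq> edges G \<and>
     (\<forall>a\<in>set_btree B. \<forall>b\<in>verts G. {a, b} \<in> edges G \<longrightarrow>
        {a, b} \<in> btree_edges B \<or> a = root_label B \<and> b \<notin> set_btree B)"

lemma attached_at_root_btree_graph: "attached_at_root (btree_graph B) B"
  by (auto simp: attached_at_root_def btree_graph_def)

lemma attached_at_root_branches:
  assumes att: "attached_at_root G (Br l r)" and dist: "leaves_distinct (Br l r)"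
  shows "attached_at_root G l" "attached_at_root G r" "bridge G (set_btree r) (root_label l) (root_label r)"
proof -
  have disj: "set_btree l \<inter> set_btree r = {}" using dist by simp
  have lr: "root_label l \<in> set_btree l" "root_label r \<in> set_btree r" by simp_all
  have V: "set_btree l \<subseteq> verts G" "set_btree r \<subseteq> verts G"
    and E: "btree_edges l \<subseteq> edges G" "btree_edges r \<subseteq> edges G" "{root_label l, root_label r} \<in> edges G"
    using att by (auto simp: attached_at_root_def)
  have l: "{a, b} \<in> btree_edges l \<or> a = root_label l \<and> b \<notin> set_btree l"
    if "a \<in> set_btree l" "b \<in> verts G" "{a, b} \<in> edges G" for a b
  proof -
    have "a \<in> set_btree (Br l r)" using that by simp
    then have "{a, b} \<in> btree_edges (Br l r) \<or> a = root_label (Br l r) \<and> b \<notin> set_btree (Br l r)"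
      using att that(2,3) unfolding attached_at_root_def by blast
    then have "{a, b} \<in> btree_edges (Br l r) \<or> a = root_label l \<and> b \<notin> set_btree l" by auto
    moreover have "{a, b} \<notin> btree_edges r" using btree_edges_subset[of "{a, b}" r] that disj by auto
    moreover have "a = root_label l \<and> b = root_label r" if "{a, b} = {root_label l, root_label r}"
      using that lr disj \<open>a \<in> set_btree l\<close> by (auto simp: doubleton_eq_iff)
    ultimately show ?thesis using lr disj by auto
  qed
  have r: "{a, b} \<in> btree_edges r \<or> a = root_label r \<and> b = root_label l"
    if "a \<in> set_btree r" "b \<in> verts G" "{a, b} \<in> edges G" for a b
  proof -
    have "a \<noteq> root_label l" using that(1) lr(1) disj by blast
    moreover have "a \<in> set_btree (Br l r)" using that by simp
    then have "{a, b} \<in> btree_edges (Br l r) \<or> a = root_label (Br l r) \<and> b \<notin> set_btree (Br l r)"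
      using att that(2,3) unfolding attached_at_root_def by blast
    ultimately have "{a, b} \<in> btree_edges (Br l r)" by auto
    moreover have "{a, b} \<notin> btree_edges l" using btree_edges_subset[of "{a, b}" l] that disj by auto
    moreover have "a = root_label r \<and> b = root_label l" if "{a, b} = {root_label l, root_label r}"
      using that \<open>a \<noteq> root_label l\<close> by (auto simp: doubleton_eq_iff)
    ultimately show ?thesis by auto
  qed
  show "attached_at_root G l" using V E l unfolding attached_at_root_def by blast
  have "root_label l \<notin> set_btree r" using lr(1) disj by blast
  then show "attached_at_root G r" using V E r unfolding attached_at_root_def by blast
  have "a = root_label r \<and> b = root_label l" if "a \<in> set_btree r" "b \<in> verts G - set_btree r" "{a, b} \<in> edges G" for a b
    using r[of a b] btree_edges_subset[of "{a, b}" r] that by auto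
  then show "bridge G (set_btree r) (root_label l) (root_label r)"
    unfolding bridge_def using V E lr \<open>root_label l \<notin> set_btree r\<close> by blast
qed

text \<open>Each descent into a right branch moves the root across one bridge; skipping a child leaves the root where it is.\<close>

lemma phi_root_eq_phi_times_odds:
  assumes conn: "connected_graph G" and fin: "finite (verts G)" and dist: "leaves_distinct B"
    and att: "attached_at_root G B" and v: "v \<in> set_btree B"
  shows "real (phi G (root_label B)) = real (phi G v) * odds (card (verts G)) B (address B v)"
  using dist att v
proof (induction B)
  case (Br l r)
  note branches = attached_at_root_branches[OF Br.prems(2,1)]
  show ?case
  proof (cases "v \<in> set_btree r")
    case True
    have sub: "set_btree l \<union> set_btree r \<subseteq> verts G" using Br.prems by (auto simp: attached_at_root_def)
    then have "card (set_btree (Br l r)) \<le> card (verts G)" using fin by (intro card_mono) auto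
    then have le: "leaves l + leaves r \<le> card (verts G)" using card_set_btree[OF Br.prems(1)] by simp
    have "phi G (root_label r) * leaves r = phi G (root_label l) * (card (verts G) - leaves r)"
      using phi_across_bridge[OF branches(3) conn fin] Br.prems by (simp add: card_set_btree)
    then have "real (phi G (root_label r)) * leaves r = real (phi G (root_label l)) * (real (card (verts G)) - leaves r)"
      using le by (metis add_leD2 of_nat_diff of_nat_mult)
    moreover have "real (card (verts G)) - leaves r > 0" using le leaves_pos[of l] by linarith
    ultimately have "real (phi G (root_label l)) = leaves r / (real (card (verts G)) - leaves r) * real (phi G (root_label r))"
      by (simp add: field_simps)
    then show ?thesis using True Br branches by (simp add: mult_ac)
  next
    case False
    then have v: "v \<in> set_btree l" using Br.prems by simp
    then have "real (phi G (root_label l)) = real (phi G v) * odds (card (verts G)) l (address l v)"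
      using Br branches by simp
    then show ?thesis using False by (cases "address l v") auto
  qed
qed simp

lemma odds_nonneg: "leaves B \<le> n \<Longrightarrow> odds n B js \<ge> 0"
  by (induction n B js rule: odds.induct) (auto intro!: mult_nonneg_nonneg)

section \<open>Averages over a uniform split\<close>

text \<open>The average of \<open>(U / N) ^ a\<close> over \<open>0 < U < N\<close> never exceeds its continuous analogue \<open>1 / (a + 1)\<close>; there is no loss of a constant, which matters because this factor is applied an unbounded number of times. The induction step is Bernoulli's inequality.\<close>

lemma sum_power_below_le:
  fixes N a :: nat
  assumes "N \<ge> 1"
  shows "(\<Sum>U=1..<N. real U ^ a) \<le> (real N - 1) * real N ^ a / (real a + 1)"
  using assms
proof (induction N rule: nat_induct_at_least)
  case base
  then show ?case by simp
next
  case (Suc N)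
  then have N: "real N > 0" by simp
  \<comment> \<open>After cancelling the common factor this is the induction step.\<close>
  have "1 + real a * (1 / real N) \<le> (1 + 1 / real N) ^ a"
    by (rule Bernoulli_inequality) (use N in \<open>simp add: field_simps\<close>)
  then have "(real N * real N ^ a) * (1 + real a * (1 / real N)) \<le> (real N * real N ^ a) * (1 + 1 / real N) ^ a"
    by (intro mult_left_mono) auto
  also have "(real N * real N ^ a) * (1 + real a * (1 / real N)) = real N ^ a * (real N + real a)"
    using N by (simp add: field_simps)
  also have "(real N * real N ^ a) * (1 + 1 / real N) ^ a = real N * (real N * (1 + 1 / real N)) ^ a"
    by (simp only: power_mult_distrib mult.assoc)
  also have "real N * (1 + 1 / real N) = real (Suc N)"
    using N by (simp add: field_simps)
  finally have B: "real N ^ a * (real N + real a) \<le> real N * real (Suc N) ^ a" .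
  have "(\<Sum>U=1..<Suc N. real U ^ a) = (\<Sum>U=1..<N. real U ^ a) + real N ^ a"
    using Suc.hyps by simp
  also have "\<dots> \<le> (real N - 1) * real N ^ a / (real a + 1) + real N ^ a"
    using Suc.IH by simp
  also have "\<dots> = real N ^ a * (real N + real a) / (real a + 1)"
    by (simp add: field_simps)
  also have "\<dots> \<le> real N * real (Suc N) ^ a / (real a + 1)"
    using B by (intro divide_right_mono) auto
  finally show ?case by simp
qed

definition split_mean :: "nat \<Rightarrow> (nat \<Rightarrow> real) \<Rightarrow> real" where
  "split_mean N f = (\<Sum>U=1..<N. f U) / (real N - 1)"

lemma split_mean_mono:
  assumes "N \<ge> 1" "\<And>U. 1 \<le> U \<Longrightarrow> U < N \<Longrightarrow> f U \<le> g U"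
  shows "split_mean N f \<le> split_mean N g"
  unfolding split_mean_def using assms by (intro divide_right_mono sum_mono) auto

lemma split_mean_cong:
  assumes "\<And>U. 1 \<le> U \<Longrightarrow> U < N \<Longrightarrow> f U = g U"
  shows "split_mean N f = split_mean N g"
  unfolding split_mean_def using assms by (intro arg_cong2[where f = "(/)"] sum.cong) auto

lemma split_mean_cmult: "split_mean N (\<lambda>U. c * f U) = c * split_mean N f"
  unfolding split_mean_def by (simp add: sum_distrib_left)

lemma split_mean_nonneg:
  assumes "N \<ge> 1" "\<And>U. 1 \<le> U \<Longrightarrow> U < N \<Longrightarrow> 0 \<le> f U"
  shows "0 \<le> split_mean N f"
  unfolding split_mean_def using assms by (intro divide_nonneg_nonneg sum_nonneg) auto

lemma sum_reflect: "(\<Sum>U=1..<N. f (N - U)) = (\<Sum>U=1..<N. f (U::nat))"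
  by (rule sum.reindex_bij_witness[of _ "\<lambda>U. N - U" "\<lambda>U. N - U"]) auto

lemma split_mean_reflect: "split_mean N (\<lambda>U. f (N - U)) = split_mean N f"
  unfolding split_mean_def by (subst sum_reflect) simp

lemma split_mean_Cauchy_Schwarz:
  assumes "N \<ge> 2"
  shows "(split_mean N (\<lambda>U. f U * g U))\<^sup>2 \<le> split_mean N (\<lambda>U. (f U)\<^sup>2) * split_mean N (\<lambda>U. (g U)\<^sup>2)"
  unfolding split_mean_def power_divide times_divide_times_eq power2_eq_square[of "real N - 1"]
  by (intro divide_right_mono Cauchy_Schwarz_ineq_sum) auto

lemma split_mean_power_mean:
  assumes "N \<ge> 2"
  shows "split_mean N f \<le> sqrt (split_mean N (\<lambda>U. (f U)\<^sup>2))"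
proof -
  have "split_mean N (\<lambda>U. (1::real)\<^sup>2) = 1"
    using assms by (simp add: split_mean_def of_nat_diff)
  then have "(split_mean N f)\<^sup>2 \<le> split_mean N (\<lambda>U. (f U)\<^sup>2)"
    using split_mean_Cauchy_Schwarz[OF assms, of f "\<lambda>_. 1"] by simp
  then show ?thesis by (rule real_le_rsqrt)
qed

text \<open>Fractional exponents are reached from natural ones by taking square roots through the power mean inequality, twice in total.\<close>

lemma split_mean_half_power:
  assumes "N \<ge> 2"
  shows "split_mean N (\<lambda>U. (U / N) powr (m / 2)) \<le> (real m + 1) powr (-1/2)"
proof -
  have "split_mean N (\<lambda>U. (U / N) powr (m / 2)) \<le> sqrt (split_mean N (\<lambda>U. ((U / N) powr (m / 2))\<^sup>2))"
    by (rule split_mean_power_mean[OF assms])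
  also have "split_mean N (\<lambda>U. ((U / N) powr (m / 2))\<^sup>2) = split_mean N (\<lambda>U. inverse (real N ^ m) * real U ^ m)"
    by (rule split_mean_cong)
       (use assms in \<open>simp add: power2_eq_square powr_add[symmetric] powr_realpow power_divide field_simps\<close>)
  also have "\<dots> \<le> 1 / (real m + 1)"
    unfolding split_mean_cmult unfolding split_mean_def
    using sum_power_below_le[of N m] assms by (simp add: field_simps)
  also have "sqrt (1 / (real m + 1)) = (real m + 1) powr (-1/2)"
    by (simp add: powr_half_sqrt[symmetric] powr_minus_divide powr_divide)
  finally show ?thesis by simp
qed

lemma split_mean_quarter_power:
  assumes "N \<ge> 2"
  shows "split_mean N (\<lambda>U. (U / N) powr (m / 4)) \<le> (real m + 1) powr (-1/4)"
proof -
  have "split_mean N (\<lambda>U. (U / N) powr (m / 4)) \<le> sqrt (split_mean N (\<lambda>U. ((U / N) powr (m / 4))\<^sup>2))"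
    by (rule split_mean_power_mean[OF assms])
  also have "split_mean N (\<lambda>U. ((U / N) powr (m / 4))\<^sup>2) = split_mean N (\<lambda>U. (U / N) powr (m / 2))"
    by (rule split_mean_cong) (simp add: power2_eq_square powr_add[symmetric])
  also have "\<dots> \<le> (real m + 1) powr (-1/2)" by (rule split_mean_half_power[OF assms])
  also have "sqrt ((real m + 1) powr (-1/2)) = (real m + 1) powr (-1/4)"
    by (simp add: powr_half_sqrt[symmetric] powr_powr)
  finally show ?thesis by simp
qed

lemma sum_inverse_sqrt_le: "(\<Sum>U=1..k. 1 / sqrt (real U)) \<le> 2 * sqrt (real k)"
proof (induction k)
  case (Suc k)
  have *: "sqrt (real k) * sqrt (real (Suc k)) \<le> real k + 1/2"
    using arith_geo_mean_sqrt[of "real k" "real (Suc k)"] by (simp add: real_sqrt_mult)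
  then have "1 / sqrt (real (Suc k)) \<le> 2 * sqrt (real (Suc k)) - 2 * sqrt (real k)"
    by (simp add: field_simps)
  then show ?case using Suc by simp
qed simp

lemma split_mean_inverse_sqrt:
  assumes "N \<ge> 2"
  shows "split_mean N (\<lambda>U. sqrt (N / (N - U))) \<le> 4"
proof -
  have "(\<Sum>U=1..<N. sqrt (real N / real (N - U))) = (\<Sum>U=1..<N. sqrt (real N / real U))"
    by (rule sum_reflect[of "\<lambda>U. sqrt (real N / real U)"])
  also have "\<dots> = sqrt N * (\<Sum>U=1..N-1. 1 / sqrt (real U))"
    using assms by (subst sum_distrib_left, intro sum.cong) (auto simp: real_sqrt_divide)
  also have "\<dots> \<le> sqrt N * (2 * sqrt (real (N - 1)))"
    by (intro mult_left_mono sum_inverse_sqrt_le) auto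
  also have "\<dots> = 2 * sqrt (real N * (real N - 1))"
    using assms by (simp add: real_sqrt_mult of_nat_diff)
  also have "\<dots> \<le> 2 * (2 * (real N - 1))"
  proof -
    have "real N * (real N - 1) \<le> (2 * (real N - 1))\<^sup>2"
    proof -
      have "real N * (real N - 1) \<le> (4 * (real N - 1)) * (real N - 1)"
        using assms by (intro mult_right_mono) auto
      then show ?thesis by (simp add: power2_eq_square algebra_simps)
    qed
    then have "sqrt (real N * (real N - 1)) \<le> 2 * (real N - 1)"
      using assms by (intro real_le_lsqrt) auto
    then show ?thesis by simp
  qed
  finally have "(\<Sum>U=1..<N. sqrt (real N / real (N - U))) \<le> 4 * (real N - 1)" by simp
  then have "split_mean N (\<lambda>U. sqrt (real N / real (N - U))) \<le> 4"
    unfolding split_mean_def using assms by (simp add: divide_le_eq)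
  moreover have "split_mean N (\<lambda>U. sqrt (real N / real (N - U))) = split_mean N (\<lambda>U. sqrt (N / (N - U)))"
    by (rule split_mean_cong) (simp add: of_nat_diff)
  ultimately show ?thesis by simp
qed

text \<open>The cut that skips a child: the current size drops from \<open>N\<close> to \<open>N - U\<close>, with \<open>m\<close> descents still to come.\<close>

lemma split_mean_stay:
  fixes N n m :: nat
  assumes "2 \<le> N" "N \<le> n"
  shows "split_mean N (\<lambda>U. (real (N - U) / n) powr (m / 4)) \<le> (N / n) powr (m / 4) * (real m + 1) powr (-1/4)"
proof -
  have "split_mean N (\<lambda>U. (real (N - U) / n) powr (m / 4)) = split_mean N (\<lambda>U. (U / n) powr (m / 4))"
    by (rule split_mean_reflect[of N "\<lambda>U. (real U / n) powr (m / 4)"])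
  also have "\<dots> = split_mean N (\<lambda>U. (N / n) powr (m / 4) * (U / N) powr (m / 4))"
    by (rule split_mean_cong) (use assms in \<open>simp add: powr_mult[symmetric]\<close>)
  also have "\<dots> \<le> (N / n) powr (m / 4) * (real m + 1) powr (-1/4)"
    unfolding split_mean_cmult by (intro mult_left_mono split_mean_quarter_power assms) auto
  finally show ?thesis .
qed

text \<open>The cut that descends into a child contributes the factor \<open>(U / (n - U)) powr (1/4)\<close>, which is large when the child
  carries almost the whole tree. The Cauchy-Schwarz inequality separates this singularity from the power of \<open>U\<close>; the order \<open>1/4\<close> of the moment leaves
  the square of the singular part integrable, and the separation costs the factor \<open>2\<close>.\<close>

lemma split_mean_descend:
  fixes N n m :: nat
  assumes "2 \<le> N" "N \<le> n" "m \<ge> 1"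
  shows "split_mean N (\<lambda>U. (U / (real n - U)) powr (1/4) * (U / n) powr ((real m - 1) / 4))
           \<le> 2 * (N / n) powr (m / 4) * (real m + 1) powr (-1/4)"
proof -
  have "split_mean N (\<lambda>U. (U / (real n - U)) powr (1/4) * (U / n) powr ((real m - 1) / 4))
      \<le> split_mean N (\<lambda>U. (N / n) powr (m / 4) * ((U / N) powr (m / 4) * (real N / real (N - U)) powr (1/4)))"
  proof (rule split_mean_mono)
    fix U assume U: "1 \<le> U" "U < N"
    have 1: "U / (real n - U) = (U / n) * (real n / (real n - U))" using U assms by simp
    have 2: "real n / (real n - U) \<le> real N / real (N - U)"
      using U assms by (simp add: of_nat_diff field_simps mult_right_mono)
    have "(U / (real n - U)) powr (1/4) * (U / n) powr ((real m - 1) / 4)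
        = (U / n) powr (m / 4) * (real n / (real n - U)) powr (1/4)"
    proof -
      have "(U / n) powr (1/4) * (U / n) powr ((real m - 1) / 4) = (U / n) powr (m / 4)"
        by (simp add: powr_add[symmetric] add_divide_distrib[symmetric])
      moreover have "(U / (real n - U)) powr (1/4) = (U / n) powr (1/4) * (real n / (real n - U)) powr (1/4)"
        unfolding 1 using U assms by (subst powr_mult) auto
      ultimately show ?thesis by (simp add: algebra_simps)
    qed
    also have "\<dots> \<le> (U / n) powr (m / 4) * (real N / real (N - U)) powr (1/4)"
      using U assms by (intro mult_left_mono powr_mono2 2) auto
    also have "(U / n) powr (m / 4) = (N / n) powr (m / 4) * (U / N) powr (m / 4)"
      using U assms by (simp add: powr_mult[symmetric])
    finally show "(U / (real n - U)) powr (1/4) * (U / n) powr ((real m - 1) / 4)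
        \<le> (N / n) powr (m / 4) * ((U / N) powr (m / 4) * (real N / real (N - U)) powr (1/4))"
      by (simp only: mult.assoc)
  qed (use assms in simp)
  also have "\<dots> = (N / n) powr (m / 4) * split_mean N (\<lambda>U. (U / N) powr (m / 4) * (real N / real (N - U)) powr (1/4))"
    by (rule split_mean_cmult)
  also have "\<dots> \<le> (N / n) powr (m / 4) * (2 * (real m + 1) powr (-1/4))"
  proof (intro mult_left_mono power2_le_imp_le[of "split_mean N _"])
    have "(split_mean N (\<lambda>U. (U / N) powr (m / 4) * (real N / real (N - U)) powr (1/4)))\<^sup>2
      \<le> split_mean N (\<lambda>U. ((U / N) powr (m / 4))\<^sup>2) * split_mean N (\<lambda>U. ((real N / real (N - U)) powr (1/4))\<^sup>2)"
      using assms by (intro split_mean_Cauchy_Schwarz)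
    also have "split_mean N (\<lambda>U. ((U / N) powr (m / 4))\<^sup>2) = split_mean N (\<lambda>U. (U / N) powr (m / 2))"
      by (rule split_mean_cong) (simp add: power2_eq_square powr_add[symmetric])
    also have "split_mean N (\<lambda>U. ((real N / real (N - U)) powr (1/4))\<^sup>2) = split_mean N (\<lambda>U. sqrt (N / (N - U)))"
      by (rule split_mean_cong)
         (simp add: power2_eq_square powr_add[symmetric] powr_half_sqrt[symmetric] of_nat_diff)
    also have "split_mean N (\<lambda>U. (U / N) powr (m / 2)) * split_mean N (\<lambda>U. sqrt (N / (N - U)))
        \<le> (real m + 1) powr (-1/2) * 4"
      using assms by (intro mult_mono split_mean_half_power split_mean_inverse_sqrt split_mean_nonneg) auto
    also have "\<dots> = (2 * (real m + 1) powr (-1/4))\<^sup>2"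
      by (simp add: power2_eq_square powr_add[symmetric])
    finally show "(split_mean N (\<lambda>U. (U / N) powr (m / 4) * (real N / real (N - U)) powr (1/4)))\<^sup>2
        \<le> (2 * (real m + 1) powr (-1/4))\<^sup>2" .
  qed simp_all
  finally show ?thesis by (simp only: mult_ac)
qed

section \<open>The law of the shape\<close>

text \<open>One summand for each leaf: the value of \<open>f\<close> at the tree in which that leaf is split.\<close>

fun split_sum :: "unit btree \<Rightarrow> (unit btree \<Rightarrow> real) \<Rightarrow> real" where
  "split_sum (Leaf x) f = f (Br (Leaf x) (Leaf x))"
| "split_sum (Br l r) f = split_sum l (\<lambda>l'. f (Br l' r)) + split_sum r (\<lambda>r'. f (Br l r'))"

text \<open>The expectation of \<open>f\<close> over the random shape with \<open>N\<close> leaves that is built top-down: the right branch has \<open>U\<close> leaves, with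
  \<open>U\<close> uniform on \<open>{1..<N}\<close>, and both branches are independent random shapes of their sizes.\<close>

function shape_mean :: "nat \<Rightarrow> (unit btree \<Rightarrow> real) \<Rightarrow> real" where
  "shape_mean N f = (if N \<le> 1 then f (Leaf ())
     else (\<Sum>U=1..<N. shape_mean (N - U) (\<lambda>l. shape_mean U (\<lambda>r. f (Br l r)))) / (real N - 1))"
  by auto
termination by (relation "Wellfounded.measure fst") auto

declare shape_mean.simps [simp del]

lemma shape_mean_1: "shape_mean (Suc 0) f = f (Leaf ())"
  by (simp add: shape_mean.simps)

lemma shape_mean_split:
  assumes "N \<ge> 2"
  shows "shape_mean N f = split_mean N (\<lambda>U. shape_mean (N - U) (\<lambda>l. shape_mean U (\<lambda>r. f (Br l r))))"
  using assms by (subst shape_mean.simps) (simp add: split_mean_def)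

lemma shape_mean_add: "shape_mean N (\<lambda>B. f B + g B) = shape_mean N f + shape_mean N g"
proof (induction N arbitrary: f g rule: less_induct)
  case (less N)
  show ?case
  proof (cases "N \<le> 1")
    case False
    have "shape_mean (N - U) (\<lambda>l. shape_mean U (\<lambda>r. f (Br l r) + g (Br l r)))
        = shape_mean (N - U) (\<lambda>l. shape_mean U (\<lambda>r. f (Br l r)))
        + shape_mean (N - U) (\<lambda>l. shape_mean U (\<lambda>r. g (Br l r)))" if "U \<in> {1..<N}" for U
      using that less by simp
    then show ?thesis using False
      by (simp add: shape_mean.simps[of N] sum.distrib add_divide_distrib)
  qed (simp add: shape_mean.simps[of N])
qed

lemma shape_mean_cmult: "shape_mean N (\<lambda>B. c * f B) = c * shape_mean N f"
proof (induction N arbitrary: f rule: less_induct)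
  case (less N)
  show ?case
  proof (cases "N \<le> 1")
    case False
    have "shape_mean (N - U) (\<lambda>l. shape_mean U (\<lambda>r. c * f (Br l r)))
        = c * shape_mean (N - U) (\<lambda>l. shape_mean U (\<lambda>r. f (Br l r)))" if "U \<in> {1..<N}" for U
      using that less by simp
    then show ?thesis using False
      by (simp add: shape_mean.simps[of N] sum_distrib_left)
  qed (simp add: shape_mean.simps[of N])
qed

lemma shape_mean_const: "shape_mean N (\<lambda>B. c) = c"
proof (induction N rule: less_induct)
  case (less N)
  then show ?case
    by (simp add: shape_mean.simps[of N] of_nat_diff)
qed

lemma shape_mean_cong:
  assumes "N \<ge> 1" "\<And>B. leaves B = N \<Longrightarrow> f B = g B"
  shows "shape_mean N f = shape_mean N g"
  using assms
proof (induction N arbitrary: f g rule: less_induct)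
  case (less N)
  show ?case
  proof (cases "N = 1")
    case False
    then have "N \<ge> 2" using less.prems by simp
    then show ?thesis
      unfolding shape_mean_split[OF \<open>N \<ge> 2\<close>]
    proof (intro split_mean_cong less.IH)
      fix U and l r :: "unit btree"
      assume "1 \<le> U" "U < N" "leaves l = N - U" "leaves r = U"
      then show "f (Br l r) = g (Br l r)" by (intro less.prems) simp
    qed auto
  qed (use less.prems in \<open>simp add: shape_mean_1\<close>)
qed

lemma shape_mean_split_sum_swap:
  "shape_mean U (\<lambda>r. split_sum B (\<lambda>B'. f B' r)) = split_sum B (\<lambda>B'. shape_mean U (f B'))"
  by (induction B arbitrary: f) (auto simp: shape_mean_add)

text \<open>Splitting a uniformly chosen leaf turns the top-down law with \<open>N\<close> leaves into the one with \<open>N + 1\<close> leaves. This is the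
  Polya urn in its uniform case: a right branch of size \<open>U\<close> arises from size \<open>U - 1\<close> in \<open>U - 1\<close> ways and from an unchanged right
  branch in \<open>N - U\<close> ways, and these add up to \<open>N - 1\<close> whatever \<open>U\<close> is.\<close>

theorem shape_mean_step:
  assumes "N \<ge> 1"
  shows "shape_mean N (\<lambda>B. split_sum B f) = N * shape_mean (Suc N) f"
  using assms
proof (induction N arbitrary: f rule: less_induct)
  case (less N)
  show ?case
  proof (cases "N = 1")
    case True
    then show ?thesis by (simp add: shape_mean_1 shape_mean.simps[of "Suc (Suc 0)"])
  next
    case False
    then have N: "N \<ge> 2" using less.prems by simp
    \<comment> \<open>\<open>A p q\<close> is the contribution of the trees whose branches have \<open>p\<close> and \<open>q\<close> leaves.\<close>
    define A where "A p q = shape_mean p (\<lambda>l. shape_mean q (\<lambda>r. f (Br l r)))" for p q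
    have left: "shape_mean (N - U) (\<lambda>l. shape_mean U (\<lambda>r. split_sum l (\<lambda>l'. f (Br l' r))))
        = real (N - U) * A (Suc N - U) U" if "U \<in> {1..<N}" for U
      using that by (subst shape_mean_split_sum_swap, subst less.IH) (auto simp: A_def Suc_diff_le)
    have right: "shape_mean (N - U) (\<lambda>l. shape_mean U (\<lambda>r. split_sum r (\<lambda>r'. f (Br l r'))))
        = real U * A (N - U) (Suc U)" if "U \<in> {1..<N}" for U
      using that less.IH[of U] by (simp add: A_def shape_mean_cmult)
    have "(\<Sum>U=1..<N. shape_mean (N - U) (\<lambda>l. shape_mean U (\<lambda>r. split_sum (Br l r) f)))
        = (\<Sum>U=1..<N. real (N - U) * A (Suc N - U) U) + (\<Sum>U=1..<N. real U * A (N - U) (Suc U))"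
      unfolding sum.distrib[symmetric]
      by (intro sum.cong refl) (simp add: shape_mean_add left right)
    \<comment> \<open>Both sums are indexed by the new right size, ranging over \<open>{1..N}\<close>; the added terms \<open>U = N\<close> and \<open>U = 1\<close> vanish.\<close>
    also have "(\<Sum>U=1..<N. real (N - U) * A (Suc N - U) U) = (\<Sum>U=1..<Suc N. (real N - U) * A (Suc N - U) U)"
      using N by (simp add: of_nat_diff)
    also have "(\<Sum>U=1..<N. real U * A (N - U) (Suc U)) = (\<Sum>U=Suc 1..<Suc N. (real U - 1) * A (Suc N - U) U)"
      by (subst sum.shift_bounds_Suc_ivl) simp
    also have "\<dots> = (\<Sum>U=1..<Suc N. (real U - 1) * A (Suc N - U) U)"
      using N by (subst (2) sum.atLeast_Suc_lessThan) auto
    also have "(\<Sum>U=1..<Suc N. (real N - U) * A (Suc N - U) U) + (\<Sum>U=1..<Suc N. (real U - 1) * A (Suc N - U) U)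
        = (real N - 1) * (\<Sum>U=1..<Suc N. A (Suc N - U) U)"
      unfolding sum_distrib_left sum.distrib[symmetric] by (intro sum.cong refl) (simp add: algebra_simps)
    also have "(\<Sum>U=1..<Suc N. A (Suc N - U) U) = N * shape_mean (Suc N) f"
      using N by (subst shape_mean.simps) (simp add: A_def)
    finally show ?thesis
      using N by (subst shape_mean.simps) simp
  qed
qed

section \<open>Uniform attachment as leaf splitting\<close>

fun split_leaf :: "'a \<Rightarrow> 'a \<Rightarrow> 'a btree \<Rightarrow> 'a btree" where
  "split_leaf i k (Leaf x) = (if x = i then Br (Leaf i) (Leaf k) else Leaf x)"
| "split_leaf i k (Br l r) = Br (split_leaf i k l) (split_leaf i k r)"

lemma split_leaf_absent: "i \<notin> set_btree B \<Longrightarrow> split_leaf i k B = B"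
  by (induction B) auto

lemma root_split_leaf [simp]: "root_label (split_leaf i k B) = root_label B"
  by (induction B) auto

lemma set_split_leaf: "i \<in> set_btree B \<Longrightarrow> set_btree (split_leaf i k B) = insert k (set_btree B)"
proof (induction B)
  case (Br l r)
  then show ?case
    by (cases "i \<in> set_btree l"; cases "i \<in> set_btree r") (auto simp: split_leaf_absent)
qed auto

lemma split_leaf_properties:
  assumes "leaves_distinct B" "i \<in> set_btree B" "k \<notin> set_btree B"
  shows "btree_edges (split_leaf i k B) = insert {i, k} (btree_edges B)"
    and "leaves_distinct (split_leaf i k B)"
proof -
  have "btree_edges (split_leaf i k B) = insert {i, k} (btree_edges B) \<and> leaves_distinct (split_leaf i k B)"
    using assms
  proof (induction B)
    case (Br l r)
    consider "i \<in> set_btree l" "i \<notin> set_btree r" | "i \<in> set_btree r" "i \<notin> set_btree l"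
      using Br.prems by auto
    then show ?case
      by cases (use Br in \<open>auto simp: split_leaf_absent set_split_leaf\<close>)
  qed auto
  then show "btree_edges (split_leaf i k B) = insert {i, k} (btree_edges B)"
    and "leaves_distinct (split_leaf i k B)" by simp_all
qed

abbreviation shape :: "'a btree \<Rightarrow> unit btree" where
  "shape \<equiv> map_btree (\<lambda>_. ())"

lemma leaves_map_btree [simp]: "leaves (map_btree h B) = leaves B"
  by (induction B) auto

lemma odds_map_btree [simp]: "odds n (map_btree h B) js = odds n B js"
  by (induction n B js rule: odds.induct) auto

lemma sum_split_leaf_shape:
  assumes "leaves_distinct B"
  shows "(\<Sum>i\<in>set_btree B. f (shape (split_leaf i k B))) = split_sum (shape B) f"
  using assms
proof (induction B arbitrary: f)
  case (Br l r)
  have disj: "set_btree l \<inter> set_btree r = {}" using Br.prems by simp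
  have "(\<Sum>i\<in>set_btree (Br l r). f (shape (split_leaf i k (Br l r))))
      = (\<Sum>i\<in>set_btree l. f (Br (shape (split_leaf i k l)) (shape (split_leaf i k r))))
      + (\<Sum>i\<in>set_btree r. f (Br (shape (split_leaf i k l)) (shape (split_leaf i k r))))"
    using disj by (simp add: sum.union_disjoint)
  also have "(\<Sum>i\<in>set_btree l. f (Br (shape (split_leaf i k l)) (shape (split_leaf i k r))))
      = (\<Sum>i\<in>set_btree l. f (Br (shape (split_leaf i k l)) (shape r)))"
    using disj by (intro sum.cong refl) (metis disjoint_iff split_leaf_absent)
  also have "(\<Sum>i\<in>set_btree r. f (Br (shape (split_leaf i k l)) (shape (split_leaf i k r))))
      = (\<Sum>i\<in>set_btree r. f (Br (shape l) (shape (split_leaf i k r))))"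
    using disj by (intro sum.cong refl) (metis disjoint_iff split_leaf_absent)
  finally show ?case
    using Br.IH(1)[of "\<lambda>l'. f (Br l' (shape r))"] Br.IH(2)[of "\<lambda>r'. f (Br (shape l) r')"] Br.prems by simp
qed simp

text \<open>The index counts attachments, so \<open>grown_btree m\<close> has \<open>m + 1\<close> leaves; unlike \<open>UA\<close> it starts from a single vertex.\<close>

primrec grown_btree :: "nat \<Rightarrow> nat btree pmf" where
  "grown_btree 0 = return_pmf (Leaf 1)"
| "grown_btree (Suc m) = do {
     B \<leftarrow> grown_btree m;
     i \<leftarrow> pmf_of_set {1..Suc m};
     return_pmf (split_leaf i (Suc (Suc m)) B)
   }"

lemma set_pmf_grown_btree:
  assumes "B \<in> set_pmf (grown_btree m)"
  shows "leaves_distinct B" "set_btree B = {1..Suc m}" "root_label B = 1" "is_tree (btree_graph B)"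
proof -
  have "leaves_distinct B \<and> set_btree B = {1..Suc m} \<and> root_label B = 1 \<and> is_tree (btree_graph B)"
    using assms
  proof (induction m arbitrary: B)
    case 0
    have "is_tree ({1::nat}, {})"
      by (auto simp: is_tree_def simple_graph_def connected_graph_def acyclic_graph_def is_path_between_def
          is_path_Cons intro!: exI[of _ "[1]"])
    then show ?case using 0 by (simp add: btree_graph_def)
  next
    case (Suc m)
    then obtain B' i where B': "B' \<in> set_pmf (grown_btree m)" and i: "i \<in> {1..Suc m}"
      and B: "B = split_leaf i (Suc (Suc m)) B'"
      by auto
    note IH = Suc.IH[OF B']
    have "is_tree (insert (Suc (Suc m)) (set_btree B'), insert {i, Suc (Suc m)} (btree_edges B'))"
      using IH i by (intro is_tree_add_pendant) (auto simp: btree_graph_def)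
    then show ?case using IH i B split_leaf_properties[of B' i "Suc (Suc m)"]
      by (auto simp: btree_graph_def set_split_leaf)
  qed
  then show "leaves_distinct B" "set_btree B = {1..Suc m}" "root_label B = 1" "is_tree (btree_graph B)" by auto
qed

lemma finite_set_pmf_grown_btree [simp]: "finite (set_pmf (grown_btree m))"
  by (induction m) auto

lemma UA_eq_map_grown_btree: "UA (Suc (Suc m)) = map_pmf btree_graph (grown_btree (Suc m))"
proof (induction m)
  case 0
  have "pmf_of_set {1..Suc 0} = return_pmf 1" by (simp add: pmf_of_set_singleton)
  then show ?case
    by (auto simp: bind_return_pmf map_return_pmf btree_graph_def numeral_2_eq_2)
next
  case (Suc m)
  define n where "n = Suc (Suc m)"
  have "UA (Suc n) = bind_pmf (UA n) (\<lambda>T. bind_pmf (pmf_of_set {1..n}) (\<lambda>i.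
      return_pmf (insert (Suc n) (verts T), insert {i, Suc n} (edges T))))"
    by (simp add: n_def)
  also have "\<dots> = bind_pmf (grown_btree (Suc m)) (\<lambda>B. bind_pmf (pmf_of_set {1..n}) (\<lambda>i.
      return_pmf (insert (Suc n) (set_btree B), insert {i, Suc n} (btree_edges B))))"
    using Suc.IH by (simp add: n_def bind_map_pmf btree_graph_def del: UA.simps)
  also have "\<dots> = bind_pmf (grown_btree (Suc m)) (\<lambda>B. bind_pmf (pmf_of_set {1..n}) (\<lambda>i.
      return_pmf (btree_graph (split_leaf i (Suc n) B))))"
  proof (intro bind_pmf_cong refl)
    fix B i assume "B \<in> set_pmf (grown_btree (Suc m))" "i \<in> set_pmf (pmf_of_set {1..n})"
    then have "leaves_distinct B" "set_btree B = {1..n}" "i \<in> set_btree B"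
      using set_pmf_grown_btree[of B "Suc m"] by (auto simp: n_def)
    then show "return_pmf (insert (Suc n) (set_btree B), insert {i, Suc n} (btree_edges B))
        = return_pmf (btree_graph (split_leaf i (Suc n) B))"
      using split_leaf_properties(1)[of B i "Suc n"] set_split_leaf[of i B "Suc n"] by (simp add: btree_graph_def)
  qed
  also have "\<dots> = map_pmf btree_graph (grown_btree (Suc (Suc m)))"
    by (simp add: n_def map_bind_pmf map_return_pmf)
  finally show ?case by (simp only: n_def)
qed

text \<open>Given the tree so far, one attachment averages \<open>f\<close> over all splits of a leaf; hence \<open>shape_mean_step\<close> carries the induction from the bottom-up process to the top-down law.\<close>

lemma expectation_shape_grown_btree:
  "measure_pmf.expectation (grown_btree m) (\<lambda>B. f (shape B)) = shape_mean (Suc m) f"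
proof (induction m arbitrary: f)
  case 0
  then show ?case by (simp add: shape_mean_1)
next
  case (Suc m)
  define n where "n = Suc m"
  define step where "step B = bind_pmf (pmf_of_set {1..n}) (\<lambda>i. return_pmf (split_leaf i (Suc n) B))" for B
  have E: "measure_pmf.expectation (step B) (\<lambda>B. f (shape B)) = split_sum (shape B) f / n"
    if "B \<in> set_pmf (grown_btree m)" for B
  proof -
    have "step B = map_pmf (\<lambda>i. split_leaf i (Suc n) B) (pmf_of_set {1..n})"
      by (simp add: step_def map_pmf_def)
    then have "measure_pmf.expectation (step B) (\<lambda>B. f (shape B))
        = (\<Sum>i\<in>{1..n}. f (shape (split_leaf i (Suc n) B))) / n"
      by (simp add: integral_pmf_of_set n_def)
    also have "{1..n} = set_btree B" using set_pmf_grown_btree[OF that] by (simp add: n_def)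
    finally show ?thesis using sum_split_leaf_shape set_pmf_grown_btree[OF that] by metis
  qed
  have "measure_pmf.expectation (grown_btree (Suc m)) (\<lambda>B. f (shape B))
      = measure_pmf.expectation (bind_pmf (grown_btree m) step) (\<lambda>B. f (shape B))"
    by (simp add: step_def[abs_def] n_def)
  also have "\<dots> = (\<Sum>B\<in>set_pmf (grown_btree m). pmf (grown_btree m) B *\<^sub>R measure_pmf.expectation (step B) (\<lambda>B. f (shape B)))"
    by (rule pmf_expectation_bind) (auto simp: step_def n_def)
  also have "\<dots> = (\<Sum>B\<in>set_pmf (grown_btree m). pmf (grown_btree m) B *\<^sub>R (split_sum (shape B) f / n))"
    by (intro sum.cong refl) (simp add: E)
  also have "\<dots> = measure_pmf.expectation (grown_btree m) (\<lambda>B. split_sum (shape B) f / n)"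
    by (subst integral_measure_pmf[of "set_pmf (grown_btree m)"]) (auto simp: set_pmf_iff)
  also have "\<dots> = measure_pmf.expectation (grown_btree m) (\<lambda>B. split_sum (shape B) f) / n"
    by simp
  also have "\<dots> = shape_mean (Suc n) f"
    using Suc.IH[of "\<lambda>B. split_sum B f"] shape_mean_step[of n f] by (simp add: n_def)
  finally show ?case by (simp add: n_def)
qed

section \<open>The moment bound\<close>

text \<open>For an address \<open>js\<close> of length \<open>m\<close> the entry at position \<open>i\<close> stands for \<open>js ! i\<close> skipped children followed by one descent, all of them with \<open>m - i\<close>
  descents to come, including the one just mentioned. Each of these cuts contributes the factor \<open>(m - i + 1) powr (-1/4)\<close>, and the descent the
  additional factor \<open>2\<close> of \<open>split_mean_descend\<close>.\<close>

fun weight :: "nat list \<Rightarrow> real" where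
  "weight [] = 1"
| "weight (j # js) = 2 * (real (length js) + 2) powr (- (real j + 1) / 4) * weight js"

lemma weight_pos: "weight js > 0"
  by (induction js) (auto intro!: mult_pos_pos)

text \<open>The power of \<open>N / n\<close> is what the induction needs: each of the remaining descents contributes a ratio proportional to the current size \<open>N\<close>,
  so the moment for a subtree of size \<open>N\<close> decays with the exponent \<open>1/4\<close> per descent. At the root, where \<open>N = n\<close>, the power is \<open>1\<close>.\<close>

lemma shape_mean_odds_le:
  assumes "1 \<le> N" "N \<le> n"
  shows "shape_mean N (\<lambda>B. odds n B js powr (1/4)) \<le> (N / n) powr (length js / 4) * weight js"
  using assms
proof (induction js arbitrary: N)
  case Nil
  then show ?case by (simp add: shape_mean_const)
next
  case (Cons j js)
  define m where "m = Suc (length js)"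
  show ?case using Cons.prems
  proof (induction j arbitrary: N)
    case 0
    show ?case
    proof (cases "N = 1")
      case True
      then show ?thesis using weight_pos[of js] by (simp add: shape_mean_1)
    next
      case False
      then have N: "2 \<le> N" "N \<le> n" using 0 by auto
      have "shape_mean N (\<lambda>B. odds n B (0 # js) powr (1/4))
          = split_mean N (\<lambda>U. (U / (real n - U)) powr (1/4) * shape_mean U (\<lambda>B. odds n B js powr (1/4)))"
        unfolding shape_mean_split[OF N(1)]
      proof (rule split_mean_cong)
        fix U assume U: "1 \<le> U" "U < N"
        have "shape_mean U (\<lambda>r. odds n (Br l r) (0 # js) powr (1/4))
            = (U / (real n - U)) powr (1/4) * shape_mean U (\<lambda>r. odds n r js powr (1/4))" for l :: "unit btree"
          unfolding shape_mean_cmult[symmetric] 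
        proof (rule shape_mean_cong)
          fix r :: "unit btree" assume "leaves r = U"
          then show "odds n (Br l r) (0 # js) powr (1/4) = (U / (real n - U)) powr (1/4) * odds n r js powr (1/4)"
            using U N odds_nonneg[of r n js] by (simp add: powr_mult[symmetric])
        qed (use U in simp)
        then show "shape_mean (N - U) (\<lambda>l. shape_mean U (\<lambda>r. odds n (Br l r) (0 # js) powr (1/4)))
            = (U / (real n - U)) powr (1/4) * shape_mean U (\<lambda>B. odds n B js powr (1/4))"
          by (simp add: shape_mean_const)
      qed
      also have "\<dots> \<le> split_mean N (\<lambda>U. weight js * ((U / (real n - U)) powr (1/4) * (U / n) powr ((real m - 1) / 4)))"
      proof (rule split_mean_mono)
        fix U assume U: "1 \<le> U" "U < N"
        have "(U / (real n - U)) powr (1/4) * shape_mean U (\<lambda>B. odds n B js powr (1/4))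
            \<le> (U / (real n - U)) powr (1/4) * ((U / n) powr (length js / 4) * weight js)"
          using U N by (intro mult_left_mono Cons.IH) auto
        then show "(U / (real n - U)) powr (1/4) * shape_mean U (\<lambda>B. odds n B js powr (1/4))
            \<le> weight js * ((U / (real n - U)) powr (1/4) * (U / n) powr ((real m - 1) / 4))"
          by (simp add: m_def algebra_simps)
      qed (use N in simp)
      also have "\<dots> = weight js * split_mean N (\<lambda>U. (U / (real n - U)) powr (1/4) * (U / n) powr ((real m - 1) / 4))"
        by (rule split_mean_cmult)
      also have "\<dots> \<le> weight js * (2 * (N / n) powr (m / 4) * (real m + 1) powr (-1/4))"
        using weight_pos[of js] N by (intro mult_left_mono split_mean_descend) (auto simp: m_def)
      finally show ?thesis by (simp add: m_def algebra_simps)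
    qed
  next
    case (Suc j)
    show ?case
    proof (cases "N = 1")
      case True
      then show ?thesis using weight_pos[of js] by (simp add: shape_mean_1)
    next
      case False
      then have N: "2 \<le> N" "N \<le> n" using Suc.prems by auto
      have "shape_mean N (\<lambda>B. odds n B (Suc j # js) powr (1/4))
          = split_mean N (\<lambda>U. shape_mean (N - U) (\<lambda>B. odds n B (j # js) powr (1/4)))"
        unfolding shape_mean_split[OF N(1)] by (simp add: shape_mean_const)
      also have "\<dots> \<le> split_mean N (\<lambda>U. weight (j # js) * (real (N - U) / n) powr (m / 4))"
      proof (rule split_mean_mono)
        fix U assume U: "1 \<le> U" "U < N"
        then show "shape_mean (N - U) (\<lambda>B. odds n B (j # js) powr (1/4)) 
            \<le> weight (j # js) * (real (N - U) / n) powr (m / 4)"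
          using Suc.IH[of "N - U"] N unfolding m_def by (simp add: mult.commute)
      qed (use N in simp)
      also have "\<dots> = weight (j # js) * split_mean N (\<lambda>U. (real (N - U) / n) powr (m / 4))"
        by (rule split_mean_cmult)
      also have "\<dots> \<le> weight (j # js) * ((N / n) powr (m / 4) * (real m + 1) powr (-1/4))"
        using weight_pos[of "j # js"] N by (intro mult_left_mono split_mean_stay) (auto simp: m_def)
      also have "\<dots> = (N / n) powr (m / 4) * weight (Suc j # js)"
      proof -
        have "(real m + 1) powr (- (real j + 1) / 4) * (real m + 1) powr (-1/4) = (real m + 1) powr (- (real (Suc j) + 1) / 4)"
          unfolding powr_add[symmetric] by (rule arg_cong[where f = "\<lambda>e. (real m + 1) powr e"]) (simp add: field_simps)
        then show ?thesis by (simp add: m_def algebra_simps)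
      qed
      finally show ?thesis by (simp add: m_def)
    qed
  qed
qed

section \<open>Sums of powers of weights\<close>

text \<open>The sum of the geometric series over the first entry \<open>j\<close> of an address of length \<open>a\<close>, with ratio \<open>(a + 1) powr (- u)\<close>; the factor \<open>16 powr u\<close> is the descent factor \<open>2\<close> raised to the power \<open>4 * u\<close>.\<close>

definition weight_factor :: "real \<Rightarrow> nat \<Rightarrow> real" where
  "weight_factor u a = 16 powr u / ((real a + 1) powr u - 1)"

lemma weight_factor_nonneg: "u > 0 \<Longrightarrow> weight_factor u a \<ge> 0"
  unfolding weight_factor_def by (intro divide_nonneg_nonneg) (auto simp: ge_one_powr_ge_zero)

lemma sum_weight_Cons_le:
  assumes u: "u > 0"
  shows "(\<Sum>j<J. weight (j # js) powr (4 * u)) \<le> weight_factor u (Suc (length js)) * weight js powr (4 * u)"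
proof -
  define d where "d = real (length js) + 2"
  define \<rho> where "\<rho> = d powr (- u)"
  have d: "d > 1" by (simp add: d_def)
  have \<rho>: "0 < \<rho>" "\<rho> < 1" using d u by (auto simp: \<rho>_def powr_minus field_simps)
  have "weight (j # js) powr (4 * u) = 16 powr u * \<rho> ^ Suc j * weight js powr (4 * u)" for j
  proof -
    have "(2::real) powr (4 * u) = 16 powr u"
      by (simp add: powr_powr[symmetric])
    moreover have "(d powr (- (real j + 1) / 4)) powr (4 * u) = \<rho> ^ Suc j"
      unfolding \<rho>_def powr_powr powr_realpow[symmetric, OF \<rho>(1)[unfolded \<rho>_def]]
      by (rule arg_cong[where f = "\<lambda>e. d powr e"]) (simp add: field_simps)
    ultimately show ?thesis using weight_pos[of js] d by (simp add: powr_mult d_def)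
  qed
  then have "(\<Sum>j<J. weight (j # js) powr (4 * u)) = 16 powr u * (\<rho> * (\<Sum>j<J. \<rho> ^ j)) * weight js powr (4 * u)"
    by (simp add: sum_distrib_left sum_distrib_right algebra_simps)
  also have "\<dots> \<le> 16 powr u * (\<rho> / (1 - \<rho>)) * weight js powr (4 * u)"
  proof -
    have "(\<Sum>j<J. \<rho> ^ j) \<le> 1 / (1 - \<rho>)"
      using \<rho> by (simp add: sum_gp_strict divide_right_mono)
    then have "\<rho> * (\<Sum>j<J. \<rho> ^ j) \<le> \<rho> * (1 / (1 - \<rho>))" using \<rho> by (intro mult_left_mono) auto
    then show ?thesis by (intro mult_right_mono mult_left_mono) auto
  qed
  also have "\<rho> / (1 - \<rho>) = 1 / (d powr u - 1)"
    using \<rho> d u by (simp add: \<rho>_def powr_minus field_simps)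
  finally show ?thesis by (simp add: weight_factor_def d_def add_ac)
qed

lemma sum_weight_length_le:
  assumes u: "u > 0"
  shows "(\<Sum>js | set js \<subseteq> {..<J} \<and> length js = m. weight js powr (4 * u)) \<le> (\<Prod>a=1..m. weight_factor u a)"
proof (induction m)
  case 0
  have "{js. set js \<subseteq> {..<J} \<and> length js = 0} = {[] :: nat list}" by auto
  then show ?case by simp
next
  case (Suc m)
  define S where "S = {js. set js \<subseteq> {..<J} \<and> length js = m}"
  have fin: "finite S" unfolding S_def by (rule finite_lists_length_eq) simp
  have "{js. set js \<subseteq> {..<J} \<and> length js = Suc m} = (\<lambda>(js, j). j # js) ` (S \<times> {..<J})"
    by (force simp: S_def length_Suc_conv image_iff)
  moreover have "inj_on (\<lambda>(js, j). j # js) (S \<times> {..<J})" by (auto simp: inj_on_def)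
  ultimately have "(\<Sum>js | set js \<subseteq> {..<J} \<and> length js = Suc m. weight js powr (4 * u))
      = (\<Sum>(js, j)\<in>S \<times> {..<J}. weight (j # js) powr (4 * u))"
    by (simp only: sum.reindex o_def case_prod_unfold)
  also have "\<dots> = (\<Sum>js\<in>S. \<Sum>j<J. weight (j # js) powr (4 * u))"
    using fin by (simp add: sum.cartesian_product)
  also have "\<dots> \<le> (\<Sum>js\<in>S. weight_factor u (Suc m) * weight js powr (4 * u))"
    by (intro sum_mono order.trans[OF sum_weight_Cons_le[OF u]]) (auto simp: S_def)
  also have "\<dots> = weight_factor u (Suc m) * (\<Sum>js\<in>S. weight js powr (4 * u))"
    by (simp add: sum_distrib_left)
  also have "\<dots> \<le> weight_factor u (Suc m) * (\<Prod>a=1..m. weight_factor u a)"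
    using Suc.IH unfolding S_def by (intro mult_left_mono weight_factor_nonneg u)
  finally show ?case by (simp add: mult.commute)
qed

text \<open>Beyond \<open>a \<approx> 16 * 3 powr (1 / u)\<close> the factors are at most \<open>1/2\<close>, and each of the earlier ones is bounded by a constant multiple of
  \<open>1 / u\<close>. The geometric factor \<open>(1/2) ^ m\<close> is extracted from all of them, so that the bound can be summed over the length \<open>m\<close>.\<close>

lemma prod_weight_factor_le:
  assumes u: "0 < u" "u \<le> 6"
  defines "A \<equiv> nat \<lceil>16 * 3 powr (1 / u)\<rceil>" and "Y \<equiv> 2 ^ 26 / u"
  shows "(\<Prod>a=1..m. weight_factor u a) \<le> (1/2) ^ m * Y ^ A"
proof -
  have Y: "Y \<ge> 1" using u by (simp add: Y_def)
  have small: "weight_factor u a \<le> 1/2 * Y" if "a \<ge> 1" for a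
  proof -
    have "u / 2 = 1 / 2 * u" by simp
    also have "\<dots> \<le> ln 2 * u" using ln2_ge_two_thirds u by (intro mult_right_mono) auto
    also have "\<dots> \<le> exp (ln 2 * u) - 1" using exp_ge_add_one_self[of "ln 2 * u"] by linarith
    also have "\<dots> = 2 powr u - 1" by (simp add: powr_def mult.commute)
    also have "\<dots> \<le> (real a + 1) powr u - 1" using that u by (intro diff_right_mono powr_mono2) auto
    finally have "u / 2 \<le> (real a + 1) powr u - 1" .
    moreover have "16 powr u \<le> (2 ^ 24 :: real)"
    proof -
      have "16 powr u \<le> (16::real) powr real 6" using u by (intro powr_mono) auto
      also have "\<dots> = 2 ^ 24" by (subst powr_realpow) auto
      finally show ?thesis .
    qed
    ultimately have "weight_factor u a \<le> 2 ^ 24 / (u / 2)"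
      unfolding weight_factor_def using u by (intro frac_le) auto
    then show ?thesis by (simp add: Y_def field_simps)
  qed
  have large: "weight_factor u a \<le> 1/2" if "a > A" for a
  proof -
    have "16 * 3 powr (1 / u) \<le> real a + 1" using that unfolding A_def by linarith
    then have "(16 * 3 powr (1 / u)) powr u \<le> (real a + 1) powr u" using u by (intro powr_mono2) auto
    then have "16 powr u * 3 \<le> (real a + 1) powr u" using u by (simp add: powr_mult powr_powr)
    moreover have "16 powr u \<ge> (1::real)" using u by (simp add: ge_one_powr_ge_zero)
    ultimately show ?thesis unfolding weight_factor_def by (simp add: field_simps)
  qed
  have "(\<Prod>a=1..m. weight_factor u a) \<le> (\<Prod>a=1..m. 1/2 * (if a \<in> {1..A} then Y else 1))"
    using small large u by (intro prod_mono conjI weight_factor_nonneg) auto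
  also have "\<dots> = (1/2) ^ m * Y ^ card ({1..m} \<inter> {1..A})"
    unfolding prod.distrib by (subst prod.inter_restrict[symmetric]) auto
  also have "\<dots> \<le> (1/2) ^ m * Y ^ A"
    using Y card_mono[of "{1..A}" "{1..m} \<inter> {1..A}"] by (intro mult_left_mono power_increasing) auto
  finally show ?thesis .
qed

lemma sum_weight_le:
  assumes X: "finite X" and u: "0 < u" "u \<le> 6"
  shows "(\<Sum>js\<in>X. weight js powr (4 * u)) \<le> exp (460 * 9 powr (1 / u))"
proof -
  define A Y where "A = nat \<lceil>16 * 3 powr (1 / u)\<rceil>" and "Y = 2 ^ 26 / u"
  have Y: "Y \<ge> 1" using u by (simp add: Y_def)
  \<comment> \<open>A box that contains \<open>X\<close>: entries below \<open>J\<close> and lengths below \<open>M\<close>.\<close>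
  define J where "J = Suc (Max (insert 0 (\<Union>js\<in>X. set js)))"
  define M where "M = Suc (Max (insert 0 (length ` X)))"
  define L where "L m = {js. set js \<subseteq> {..<J} \<and> length js = m}" for m
  have finL: "finite (L m)" for m unfolding L_def by (rule finite_lists_length_eq) simp
  have "set js \<subseteq> {..<J}" "length js < M" if "js \<in> X" for js
  proof -
    show "set js \<subseteq> {..<J}"
    proof
      fix j assume "j \<in> set js"
      then have "j \<le> Max (insert 0 (\<Union>js\<in>X. set js))" using that X by (intro Max_ge) auto
      then show "j \<in> {..<J}" by (simp add: J_def)
    qed
    have "length js \<le> Max (insert 0 (length ` X))" using that X by (intro Max_ge) auto
    then show "length js < M" by (simp add: M_def)
  qed
  then have "X \<subseteq> (\<Union>m<M. L m)" by (auto simp: L_def)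
  then have "(\<Sum>js\<in>X. weight js powr (4 * u)) \<le> (\<Sum>js\<in>(\<Union>m<M. L m). weight js powr (4 * u))"
    using finL by (intro sum_mono2) auto
  also have "\<dots> = (\<Sum>m<M. \<Sum>js\<in>L m. weight js powr (4 * u))"
    using finL by (intro sum.UNION_disjoint) (auto simp: L_def)
  also have "\<dots> \<le> (\<Sum>m<M. (1/2) ^ m * Y ^ A)"
    unfolding L_def A_def Y_def
    by (intro sum_mono order.trans[OF sum_weight_length_le prod_weight_factor_le] u)
  also have "\<dots> = (\<Sum>m<M. (1/2) ^ m) * Y ^ A"
    by (simp add: sum_distrib_right)
  also have "\<dots> \<le> 2 * Y ^ A"
    using Y by (intro mult_right_mono) (auto simp: sum_gp_strict)
  also have "\<dots> = exp (ln 2 + A * ln Y)"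
    using Y by (simp add: exp_add exp_of_nat_mult)
  also have "\<dots> \<le> exp (460 * 9 powr (1 / u))"
  proof -
    define t where "t = (3::real) powr (1 / u)"
    have t: "t \<ge> 1" using u by (simp add: t_def ge_one_powr_ge_zero)
    have tu: "1 / u \<le> t"
    proof -
      have "1 / u \<le> ln 3 * (1 / u)" using ln3_gt_1 u by (simp add: divide_right_mono)
      also have "\<dots> \<le> exp (ln 3 * (1 / u))" using exp_ge_add_one_self[of "ln 3 * (1 / u)"] by linarith
      also have "\<dots> = t" by (simp add: t_def powr_def)
      finally show ?thesis .
    qed
    have "ln Y = 26 * ln 2 + ln (1 / u)" using u ln_realpow[of "2::real" 26] by (simp only: Y_def ln_div) (simp add: ln_div)
    also have "\<dots> \<le> 26 + 1 / u" using ln_2_less_1 ln_le_minus_one[of "1 / u"] u by simp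
    also have "\<dots> \<le> 27 * t" using t tu by simp
    finally have lnY: "ln Y \<le> 27 * t" .
    have "real A \<le> 17 * t" using t unfolding A_def t_def[symmetric] by linarith
    then have "A * ln Y \<le> (17 * t) * (27 * t)" using lnY Y t by (intro mult_mono) auto
    moreover have "1 \<le> t * t" using t mult_mono[of 1 t 1 t] by simp
    ultimately have "ln 2 + A * ln Y \<le> 460 * (t * t)" using ln_2_less_1 by linarith
    also have "t * t = 9 powr (1 / u)" by (simp add: t_def powr_mult[symmetric])
    finally show ?thesis by simp
  qed
  finally show ?thesis .
qed

text \<open>Rankin's trick: an address of weight at least \<open>1 / Q\<close> contributes at least \<open>1\<close> to \<open>\<Sum> (Q * weight js) powr (4 * u)\<close>, for every \<open>u\<close>.\<close>

lemma card_heavy_addresses_le: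
  assumes X: "finite X" and Q: "Q > 0" and u: "0 < u" "u \<le> 6" and heavy: "\<And>js. js \<in> X \<Longrightarrow> 1 / Q \<le> weight js"
  shows "card X \<le> Q powr (4 * u) * exp (460 * 9 powr (1 / u))"
proof -
  have "real (card X) = (\<Sum>js\<in>X. 1)" by simp
  also have "\<dots> \<le> (\<Sum>js\<in>X. Q powr (4 * u) * weight js powr (4 * u))"
  proof (intro sum_mono)
    fix js assume "js \<in> X"
    then have "1 \<le> Q * weight js" using heavy Q by (simp add: field_simps)
    then have "1 \<le> (Q * weight js) powr (4 * u)" using u by (simp add: ge_one_powr_ge_zero)
    then show "1 \<le> Q powr (4 * u) * weight js powr (4 * u)" using Q weight_pos[of js] by (simp add: powr_mult)
  qed
  also have "\<dots> \<le> Q powr (4 * u) * exp (460 * 9 powr (1 / u))"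
    unfolding sum_distrib_left[symmetric] by (intro mult_left_mono sum_weight_le X u) auto
  finally show ?thesis .
qed

text \<open>A weight below \<open>1 / Q\<close> is at most \<open>1 / sqrt Q\<close> times its own square root, and the square roots are the powers with \<open>u = 1/8\<close>.\<close>

lemma sum_light_weight_le:
  assumes X: "finite X" and Q: "Q > 0" and light: "\<And>js. js \<in> X \<Longrightarrow> weight js < 1 / Q"
  shows "sum weight X \<le> exp (460 * 9 ^ 8) / sqrt Q"
proof -
  have "sum weight X \<le> (\<Sum>js\<in>X. sqrt (weight js) / sqrt Q)"
  proof (intro sum_mono)
    fix js assume "js \<in> X"
    then have "sqrt (weight js) \<le> sqrt (1 / Q)" using light[of js] by (intro real_sqrt_le_mono) simp
    then have "sqrt (weight js) * sqrt (weight js) \<le> sqrt (weight js) * sqrt (1 / Q)"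
      using weight_pos[of js] by (intro mult_left_mono) auto
    then show "weight js \<le> sqrt (weight js) / sqrt Q"
      using weight_pos[of js] by (simp add: real_sqrt_divide)
  qed
  also have "\<dots> = (\<Sum>js\<in>X. weight js powr (4 * (1/8))) / sqrt Q"
    using weight_pos by (simp add: sum_divide_distrib powr_half_sqrt less_imp_le)
  also have "\<dots> \<le> exp (460 * 9 powr (1 / (1/8))) / sqrt Q"
    using Q by (intro divide_right_mono sum_weight_le X) auto
  also have "9 powr (1 / (1/8)) = (9 ^ 8 :: real)"
    using powr_realpow[of 9 8] by simp
  finally show ?thesis .
qed

text \<open>With \<open>x = ln (1 / \<epsilon>)\<close>, the term \<open>9 powr (1 / u)\<close> is at most \<open>2 * sqrt x\<close>, because \<open>1 / u = (1 + ln x) / 6\<close> and \<open>ln 9 \<le> 3\<close>; this is dominated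
  by \<open>x / ln x\<close>. The exponent \<open>8 * u * x\<close> coming from \<open>Q = (exp \<beta> / \<epsilon>)\<^sup>2\<close> is of order \<open>x / ln x\<close> itself. The summand \<open>1\<close> in the
  denominator of \<open>u\<close> keeps \<open>u \<le> 6\<close> when \<open>\<epsilon>\<close> is close to \<open>1 / exp 1\<close>.\<close>

lemma heavy_address_bound_le:
  fixes \<epsilon> :: real
  assumes \<epsilon>: "0 < \<epsilon>" "\<epsilon> < 1 / exp 1"
  defines "x \<equiv> ln (1 / \<epsilon>)"
  defines "u \<equiv> 6 / (1 + ln x)"
  assumes \<beta>: "\<beta> \<ge> 0"
  shows "0 < u" "u \<le> 6"
    "((exp \<beta> / \<epsilon>)\<^sup>2) powr (4 * u) * exp (460 * 9 powr (1 / u)) \<le> exp (48 * \<beta>) * exp (1888 * (x / ln x))"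
proof -
  have "exp 1 < 1 / \<epsilon>" using \<epsilon> by (simp add: field_simps)
  then have x: "x > 1" unfolding x_def using \<epsilon> ln_less_cancel_iff[of "exp 1" "1 / \<epsilon>"] by simp
  then have L: "ln x > 0" by simp
  show u: "0 < u" "u \<le> 6" unfolding u_def using L by (auto simp: divide_le_eq)
  have "exp \<beta> / \<epsilon> = exp (\<beta> + x)" using \<epsilon> unfolding x_def exp_add by (subst exp_ln) auto
  then have Q: "((exp \<beta> / \<epsilon>)\<^sup>2) powr (4 * u) = exp (8 * u * \<beta> + 8 * u * x)"
    by (simp add: powr_def power2_eq_square ln_mult algebra_simps)
  have "8 * u * \<beta> \<le> 48 * \<beta>" using u \<beta> by (intro mult_right_mono) auto
  moreover have "8 * u * x \<le> 48 * (x / ln x)"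
  proof -
    have "u \<le> 6 / ln x" unfolding u_def using L by (intro divide_left_mono) auto
    then have "u * x \<le> 6 / ln x * x" using x by (intro mult_right_mono) auto
    then show ?thesis by simp
  qed
  moreover have "9 powr (1 / u) \<le> 4 * (x / ln x)"
  proof -
    have "9 powr (1 / u) = 9 powr (1/6) * 9 powr (ln x / 6)"
      unfolding powr_add[symmetric] by (simp add: u_def add_divide_distrib)
    also have "\<dots> \<le> 2 * sqrt x"
    proof (intro mult_mono)
      have "9 powr (1/6) \<le> (2 powr 6) powr (1/6 :: real)" by (intro powr_mono2) auto
      then show "9 powr (1/6) \<le> (2::real)" by (simp add: powr_powr)
      have "(9::real) \<le> (5/2) ^ 3" by (simp add: power3_eq_cube)
      also have "\<dots> \<le> exp 1 ^ 3" using e_approx_32 by (intro power_mono) (auto simp: abs_if split: if_splits)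
      also have "\<dots> = exp 3" by (simp add: exp_of_nat_mult[symmetric])
      finally have "ln 9 \<le> (3::real)" using ln_le_cancel_iff[of 9 "exp 3"] by simp
      then have "9 powr (ln x / 6) \<le> exp ((1/2) * ln x)"
        unfolding powr_def using L by (auto simp: mult_right_mono)
      also have "\<dots> = sqrt x" using x by (simp add: powr_half_sqrt[symmetric] powr_def)
      finally show "9 powr (ln x / 6) \<le> sqrt x" .
    qed (use x in auto)
    also have "2 * sqrt x \<le> 4 * (x / ln x)"
    proof -
      have "ln x = 2 * ln (sqrt x)" using x by (simp add: ln_sqrt)
      also have "\<dots> \<le> 2 * sqrt x" using ln_le_minus_one[of "sqrt x"] x by auto
      finally have "sqrt x * ln x \<le> sqrt x * (2 * sqrt x)" using x by (intro mult_left_mono) auto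
      also have "\<dots> = 2 * x" using x by simp
      finally show ?thesis using L by (simp add: field_simps)
    qed
    finally show ?thesis .
  qed
  ultimately have "8 * u * \<beta> + 8 * u * x + 460 * 9 powr (1 / u) \<le> 48 * \<beta> + 1888 * (x / ln x)" by linarith
  then show "((exp \<beta> / \<epsilon>)\<^sup>2) powr (4 * u) * exp (460 * 9 powr (1 / u)) \<le> exp (48 * \<beta>) * exp (1888 * (x / ln x))"
    unfolding Q by (simp only: exp_add[symmetric] exp_le_cancel_iff)
qed

section \<open>Vertex 1 is rarely missed\<close>

text \<open>Markov's inequality for the sum of the fourth roots of the odds over all light addresses in \<open>X\<close>.\<close>

lemma prob_light_contender_le:
  assumes X: "finite X" and Q: "Q > 0"
  shows "measure_pmf.prob (grown_btree m) {B. \<exists>js\<in>X. weight js < 1 / Q \<and> odds (Suc m) B js \<ge> 1}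
      \<le> exp (460 * 9 ^ 8) / sqrt Q"
proof -
  define Y where "Y = {js \<in> X. weight js < 1 / Q}"
  define F where "F = (\<lambda>B. \<Sum>js\<in>Y. odds (Suc m) (B :: nat btree) js powr (1/4))"
  have Y: "finite Y" using X by (simp add: Y_def)
  have "measure_pmf.prob (grown_btree m) {B. \<exists>js\<in>X. weight js < 1 / Q \<and> odds (Suc m) B js \<ge> 1}
      \<le> measure_pmf.prob (grown_btree m) {B. 1 \<le> F B}"
  proof (intro measure_pmf.finite_measure_mono subsetI CollectI)
    fix B :: "nat btree" assume "B \<in> {B. \<exists>js\<in>X. weight js < 1 / Q \<and> odds (Suc m) B js \<ge> 1}"
    then obtain js where js: "js \<in> Y" "odds (Suc m) B js \<ge> 1" by (auto simp: Y_def)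
    then have "1 \<le> odds (Suc m) B js powr (1/4)" by (simp add: ge_one_powr_ge_zero)
    also have "\<dots> \<le> F B" unfolding F_def using js Y by (intro member_le_sum) auto
    finally show "1 \<le> F B" .
  qed simp
  also have "\<dots> \<le> measure_pmf.expectation (grown_btree m) F / 1"
    using integral_Markov_inequality_measure[of "measure_pmf (grown_btree m)" F "{}" 1]
    by (simp add: F_def sum_nonneg integrable_measure_pmf_finite)
  also have "measure_pmf.expectation (grown_btree m) F
      = (\<Sum>js\<in>Y. measure_pmf.expectation (grown_btree m) (\<lambda>B. odds (Suc m) B js powr (1/4)))"
    unfolding F_def by (rule Bochner_Integration.integral_sum) (simp add: integrable_measure_pmf_finite)
  also have "\<dots> \<le> sum weight Y"
  proof (rule sum_mono)
    fix js
    have "measure_pmf.expectation (grown_btree m) (\<lambda>B. odds (Suc m) B js powr (1/4))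
        = shape_mean (Suc m) (\<lambda>B. odds (Suc m) B js powr (1/4))"
      using expectation_shape_grown_btree[of m "\<lambda>B. odds (Suc m) B js powr (1/4)"] by simp
    also have "\<dots> \<le> weight js" using shape_mean_odds_le[of "Suc m" "Suc m" js] by simp
    finally show "measure_pmf.expectation (grown_btree m) (\<lambda>B. odds (Suc m) B js powr (1/4)) \<le> weight js" .
  qed
  also have "\<dots> \<le> exp (460 * 9 ^ 8) / sqrt Q"
    by (rule sum_light_weight_le[OF Y Q]) (simp add: Y_def)
  finally show ?thesis by simp
qed

text \<open>If the root is missed, then the \<open>K\<close> chosen vertices all satisfy \<open>\<phi>(v) \<le> \<phi>(root)\<close>, that is, their odds are at least \<open>1\<close>. Their addresses
  are distinct, so they cannot all be heavy. The realization enters only through an isomorphism, under which \<open>\<phi>\<close> is invariant.\<close>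

lemma light_contender_exists:
  assumes realiz: "unlabeled_realization C \<iota>" and H: "is_H_phi K H"
    and B: "leaves_distinct B" "is_tree (btree_graph B)" "leaves B = n" and Kn: "K \<le> n"
    and miss: "\<iota> (btree_graph B) (root_label B) \<notin> H (C (unlabeled (btree_graph B)))"
    and few: "\<And>X. finite X \<Longrightarrow> \<forall>js\<in>X. 1 / Q \<le> weight js \<Longrightarrow> card X < K"
  shows "\<exists>v\<in>set_btree B. weight (address B v) < 1 / Q \<and> odds n B (address B v) \<ge> 1"
proof -
  define G where "G = btree_graph B"
  define S where "S = C (unlabeled G)"
  define f where "f = \<iota> G"
  have V: "verts G = set_btree B" by (simp add: G_def btree_graph_def)
  have tree: "is_tree G" and conn: "connected_graph G" and sg: "simple_graph G"
    using B by (auto simp: G_def is_tree_def)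
  have iso: "graph_iso f G S" using realiz tree unfolding unlabeled_realization_def f_def S_def by blast
  then have bij: "bij_betw f (verts G) (verts S)" by (simp add: graph_iso_def)
  have cardG: "card (verts G) = n" using B by (simp add: V card_set_btree)
  then have "card (verts S) \<ge> K" using bij_betw_same_card[OF bij] Kn by simp
  then have HS: "H S \<subseteq> verts S" "card (H S) = K" "\<And>u v. u \<in> H S \<Longrightarrow> v \<in> verts S - H S \<Longrightarrow> phi S u \<le> phi S v"
    using H is_tree_iso[OF iso tree] unfolding is_H_phi_def by blast+
  define U where "U = {v \<in> verts G. f v \<in> H S}"
  have "f ` U = H S" using HS(1) bij by (auto simp: U_def bij_betw_def)
  moreover have "inj_on f U" using bij by (auto simp: bij_betw_def U_def intro: inj_on_subset)
  ultimately have "card U = K" using HS(2) card_image by metis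
  have odds: "odds n B (address B v) \<ge> 1" if "v \<in> U" for v
  proof -
    have v: "v \<in> set_btree B" "f v \<in> H S" using that by (auto simp: U_def V)
    have "f (root_label B) \<in> verts S" using bij_betwE[OF bij] by (simp add: V)
    then have "f (root_label B) \<in> verts S - H S" using miss by (simp add: f_def S_def G_def)
    then have "phi S (f v) \<le> phi S (f (root_label B))" by (rule HS(3)[OF v(2)])
    then have "real (phi G v) * 1 \<le> real (phi G (root_label B))"
      using phi_iso[OF iso sg] v by (simp add: V)
    also have "\<dots> = real (phi G v) * odds n B (address B v)"
      using phi_root_eq_phi_times_odds[OF conn _ B(1) _ v(1)] attached_at_root_btree_graph[of B] cardG
      by (simp add: V G_def[symmetric])
    finally show ?thesis
      using phi_pos[OF conn, of v] v by (simp only: mult_le_cancel_left_pos V of_nat_0_less_iff finite_set_btree)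
  qed
  have "inj_on (address B) U" using inj_on_address[OF B(1)] by (rule inj_on_subset) (auto simp: U_def V)
  then have "card (address B ` U) = K" using \<open>card U = K\<close> by (simp add: card_image)
  moreover have "finite (address B ` U)" by (simp add: U_def V)
  ultimately have "\<exists>v\<in>U. weight (address B v) < 1 / Q" using few[of "address B ` U"] by force
  then show ?thesis using odds by (auto simp: U_def V)
qed

theorem theorem5:
  "\<exists>a b :: real. a > 0 \<and> b > 0 \<and>
     (\<forall>(\<epsilon> :: real) (K :: nat) (H :: nat graph \<Rightarrow> nat set)
        (C :: nat graph set \<Rightarrow> nat graph) (\<iota> :: nat graph \<Rightarrow> nat \<Rightarrow> nat).
        0 < \<epsilon> \<longrightarrow> \<epsilon> < 1 / exp 1 \<longrightarrow> K > 0 \<longrightarrow>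
        real K \<ge> a * exp (b * (ln (1 / \<epsilon>) / ln (ln (1 / \<epsilon>)))) \<longrightarrow>
        unlabeled_realization C \<iota> \<longrightarrow> is_H_phi K H \<longrightarrow>
        liminf (\<lambda>n. ereal (measure_pmf.prob (UA n) {T. \<iota> T 1 \<in> H (C (unlabeled T))}))
          \<ge> ereal (1 - \<epsilon>))"
proof -
  define \<beta> :: real where "\<beta> = 460 * 9 ^ 8"
  have \<beta>: "\<beta> \<ge> 0" by (simp add: \<beta>_def)
  show ?thesis
  proof (rule exI[of _ "2 * exp (48 * \<beta>)"], rule exI[of _ "1888 :: real"], intro conjI allI impI)
    fix \<epsilon> :: real and K :: nat and H :: "nat graph \<Rightarrow> nat set"
      and C :: "nat graph set \<Rightarrow> nat graph" and \<iota> :: "nat graph \<Rightarrow> nat \<Rightarrow> nat"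
    assume \<epsilon>: "0 < \<epsilon>" "\<epsilon> < 1 / exp 1" and "K > 0"
      and K: "2 * exp (48 * \<beta>) * exp (1888 * (ln (1 / \<epsilon>) / ln (ln (1 / \<epsilon>)))) \<le> real K"
      and realiz: "unlabeled_realization C \<iota>" and H: "is_H_phi K H"
    \<comment> \<open>This \<open>Q\<close> makes the bound for the total light weight equal to \<open>\<epsilon>\<close>.\<close>
    define Q where "Q = (exp \<beta> / \<epsilon>)\<^sup>2"
    define u where "u = 6 / (1 + ln (ln (1 / \<epsilon>)))"
    have Q: "Q > 0" "exp \<beta> / sqrt Q = \<epsilon>" using \<epsilon> by (auto simp: Q_def)
    note bound = heavy_address_bound_le[OF \<epsilon> \<beta>, folded u_def Q_def]
    have few: "card X < K" if "finite X" "\<forall>js\<in>X. 1 / Q \<le> weight js" for X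
    proof -
      have "real (card X) \<le> Q powr (4 * u) * exp (460 * 9 powr (1 / u))"
        using that by (intro card_heavy_addresses_le Q bound) auto
      also have "\<dots> \<le> exp (48 * \<beta>) * exp (1888 * (ln (1 / \<epsilon>) / ln (ln (1 / \<epsilon>))))" by (rule bound(3))
      also have "\<dots> < 2 * exp (48 * \<beta>) * exp (1888 * (ln (1 / \<epsilon>) / ln (ln (1 / \<epsilon>))))" by simp
      also note K
      finally show ?thesis by simp
    qed
    have *: "ereal (1 - \<epsilon>) \<le> ereal (measure_pmf.prob (UA n) {T. \<iota> T 1 \<in> H (C (unlabeled T))})"
      if n: "n \<ge> max 2 K" for n
    proof -
      obtain m where m: "n = Suc (Suc m)" using n by (metis le_add_diff_inverse max.bounded_iff add_2_eq_Suc)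
      define P where "P = grown_btree (Suc m)"
      \<comment> \<open>Only finitely many addresses occur in trees with \<open>n\<close> vertices, so the union bound is a finite sum.\<close>
      define X where "X = (\<Union>B\<in>set_pmf P. address B ` set_btree B)"
      define hit where "hit = {B. \<iota> (btree_graph B) 1 \<in> H (C (unlabeled (btree_graph B)))}"
      define bad where "bad = {B :: nat btree. \<exists>js\<in>X. weight js < 1 / Q \<and> odds n B js \<ge> 1}"
      have "(UNIV - hit) \<inter> set_pmf P \<subseteq> bad"
      proof
        fix B assume "B \<in> (UNIV - hit) \<inter> set_pmf P"
        then have B: "B \<notin> hit" "B \<in> set_pmf P" by auto
        note grown = set_pmf_grown_btree[OF B(2)[unfolded P_def]]
        have "leaves B = n" using card_set_btree[OF grown(1)] grown(2) m by simp
        then have "\<exists>v\<in>set_btree B. weight (address B v) < 1 / Q \<and> odds n B (address B v) \<ge> 1"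
          using B n by (intro light_contender_exists[OF realiz H grown(1,4) _ _ _ few]) (auto simp: hit_def grown(3))
        then show "B \<in> bad" using B by (auto simp: bad_def X_def)
      qed
      then have "measure_pmf.prob P (UNIV - hit) \<le> measure_pmf.prob P bad"
        by (subst measure_Int_set_pmf[symmetric]) (intro measure_pmf.finite_measure_mono, auto)
      also have "\<dots> \<le> exp (460 * 9 ^ 8) / sqrt Q"
        unfolding bad_def P_def m by (rule prob_light_contender_le) (auto simp: X_def P_def Q)
      also have "\<dots> = \<epsilon>" using Q by (simp add: \<beta>_def)
      finally have "1 - \<epsilon> \<le> measure_pmf.prob P hit"
        using measure_pmf.prob_compl[of hit P] by simp
      also have "\<dots> = measure_pmf.prob (UA n) {T. \<iota> T 1 \<in> H (C (unlabeled T))}"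
        unfolding m UA_eq_map_grown_btree by (simp add: P_def hit_def vimage_def)
      finally show ?thesis by simp
    qed
    show "ereal (1 - \<epsilon>) \<le> liminf (\<lambda>n. ereal (measure_pmf.prob (UA n) {T. \<iota> T 1 \<in> H (C (unlabeled T))}))"
      by (rule Liminf_bounded, rule eventually_sequentiallyI[of "max 2 K"], rule *)
  qed auto
qed

end
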